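(* Let $(\mathbf R_0,\mathbf P_0,\mathbf G_0,N)$ be a relative equilibrium which is not locally central, with total angular momentum of modulus $L$. Write $\mathbf R_0=[R_1,R_2,R_3]^T$, $\mathbf P_0=[P_1,P_2,P_3]^T$, $\mathbf G_0=[A\Omega_1,A\Omega_2,C\Omega_3]^T$, $G_3=C\Omega_3$, $\widetilde\Omega_3=\Omega_3+N$, $\widetilde{\boldsymbol\Omega}=[\Omega_1,\Omega_2,\widetilde\Omega_3]^T$, $\rho=\sqrt{R_1^2+R_2^2}$ and $$K=\rho U_\rho+R_3U_3 ,$$ all derivatives of $U$ being taken at $\mathbf R_0$. (a) Then $P_3=R_2\Omega_1-R_1\Omega_2=0$, none of $\rho$, $R_3$, $\widetilde\Omega_3$ vanishes, $U_\rho\neq0$, and $$P_1=-R_2\frac{U_\rho}{\widetilde\Omega_3\rho},\qquad P_2=R_1\frac{U_\rho}{\widetilde\Omega_3\rho},\qquad \Omega_i=R_i\frac{\rho\widetilde\Omega_3^2-U_\rho}{\rho R_3\widetilde\Omega_3}\quad(i=1,2),\tag{1}$$ $$K\,\widetilde\Omega_3^2=U_\rho^2,\tag{2}$$ $$(A\widetilde\Omega_3-C\Omega_3)\,U_\rho U_3=K\,(\rho U_3-R_3U_\rho)\,\widetilde\Omega_3,$$ $$L^2=\frac{\big[(A+R_3^2)U_3+\rho R_3U_\rho\big]^2}{K}+\Big(\frac{\rho U_\rho}{\widetilde\Omega_3}+G_3\Big)^2 .$$ (b) Eliminating $\widetilde\Omega_3$ gives the two scalar equations $$L^2U_3^2K=(U_\rho^2+U_3^2)\,[AU_3+R_3K]^2,\qquad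 C^2\Omega_3^2U_3^2K=[AU_\rho U_3+K(R_3U_\rho-\rho U_3)]^2 .\tag{3}$$ For given $L$ and $\Omega_3$, a solution of (3) gives $\mathbf R_0$, and the remaining variables of the relative equilibrium are determined by (1) and (2). (c) For such a relative equilibrium $$\boldsymbol l\cdot\boldsymbol r(t)=\langle\mathbf G_0,\mathbf R_0\rangle=\frac{U_\rho\,(AU_3+R_3K)}{U_3K\,\widetilde\Omega_3}\,(R_3U_\rho-\rho U_3),$$ and this is nonzero. Hence every relative equilibrium which is not locally central is non-Lagrangian. (d) The symmetry axis satisfies $$\boldsymbol r(t)\cdot\boldsymbol z(t)=R_3,\qquad \dot{\boldsymbol r}(t)\cdot\boldsymbol z(t)=0,\qquad \boldsymbol c(t)\cdot\boldsymbol z(t)=\langle\mathbf R_0\times(\widetilde{\boldsymbol\Omega}\times\mathbf R_0),\mathbf Z\rangle=\frac{\rho U_\rho}{\widetilde\Omega_3},$$ $$\boldsymbol l\cdot\boldsymbol z(t)=\frac{\rho U_\rho}{\widetilde\Omega_3}+C\Omega_3 .$$ Thus in the orbital frame the symmetry axis always lies in the plane formed by the relative position vector and the normal to the orbital plane, and it is inclined to the orbital plane; the vector $\boldsymbol c(t)$ is not perpendicular to the orbital planes. (This class of relative equilibria is called conic precession.)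
   Context: A point mass and a rigid body attract each other. The body has inertia tensor $\mathbf I=\operatorname{diag}(A,A,C)$, and its gravitational potential $U$ is a smooth function satisfying the axial symmetry condition $R_1\,\partial U/\partial R_2-R_2\,\partial U/\partial R_1=0$. Hence $U$ depends only on $\rho=\sqrt{R_1^2+R_2^2}$ and $R_3$; write $U_\rho=\partial U/\partial\rho$, $U_3=\partial U/\partial R_3$. The equations of motion in the body frame are $$\dot{\mathbf R}=\mathbf R\times\boldsymbol\Omega+\mathbf P,\quad \dot{\mathbf P}=\mathbf P\times\boldsymbol\Omega-\frac{\partial U}{\partial\mathbf R},\quad \dot{\mathbf G}=\mathbf G\times\boldsymbol\Omega+\mathbf R\times\frac{\partial U}{\partial\mathbf R},\qquad \boldsymbol\Omega=\mathbf I^{-1}\mathbf G,$$ where $\mathbf R$ is the vector from the mass centre of the body to the point mass, $\mathbf P$ the relative linear momentum, $\mathbf G$ the angular momentum of the body. Let $\mathbf A_3(\varphi)$ be the matrix of rotation by the angle $\varphi$ about the third axis. A relative equilibrium with data $(\mathbf R_0,\mathbf P_0,\mathbf G_0,N)$, where $\mathbf R_0\ne\mathbf 0$, $\mathbf P_0$, $\mathbf G_0$ are constant vectors and $N\in\mathbb R$, is a solution $\mathbf R(t)=\mathbf A_3(Nt)\mathbf R_0$, $\mathbf P(t)=\mathbf A_3(Nt)\mathbf P_0$, $\mathbf G(t)=\mathbf A_3(Nt)\mathbf G_0$. It is locally central if $\mathbf R_0\times\frac{\partial U}{\partial\mathbf R}(\mathbf R_0)=\mathbf 0$. The modulus of the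 total angular momentum is $L=\|\mathbf R_0\times\mathbf P_0+\mathbf G_0\|$. It is assumed throughout that $\frac{\partial U}{\partial\mathbf R}(\mathbf R_0)\neq\mathbf 0$ and $L\neq0$. In an inertial frame, $\boldsymbol l$ denotes the (constant) total angular momentum vector, $\boldsymbol r(t)$ the relative position vector, $\boldsymbol z(t)$ the unit vector along the symmetry axis of the body (with body-frame components $\mathbf Z=[0,0,1]^T$), and $\boldsymbol c(t)=\boldsymbol r(t)\times\dot{\boldsymbol r}(t)$. The orbital frame has axes parallel to $\boldsymbol r$, $\dot{\boldsymbol r}$, $\boldsymbol c$. In a relative equilibrium the relative orbit is circular and $\boldsymbol l\cdot\boldsymbol r(t)=\langle\mathbf G_0,\mathbf R_0\rangle$ is constant; the relative equilibrium is called non-Lagrangian if the orbital planes of the point mass and of the mass centre of the body are parallel but do not coincide, i.e. if this constant is nonzero.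
   Formalization: R₃, Ω̃₃, U_ρ ≠ 0 can fail (U=(R₁²+R₂²)/2+R₃ at (1,0,0); U=R₃²/2 at (1,0,1)); formulas dividing by them and the inclination are claimed only when nonzero (U_ρ≠0 iff Ω̃₃≠0; R₃≠0 if U₃=0 on the equator). In (b), R₃, U_ρ ≠ 0 assumed; for Ω₃=0 unique up to sign of (P₀,G₀,N). *)

theory Defs
  imports "HOL-Analysis.Analysis"
begin

unbundle cross3_syntax

section \<open>The potential\<close>

text \<open>Iterated partial derivatives; smooth means that all of them exist and are differentiable.\<close>

primrec iter_partial :: "3 list \<Rightarrow> (real^3 \<Rightarrow> real) \<Rightarrow> real^3 \<Rightarrow> real" where
  "iter_partial [] U = U"
| "iter_partial (i # is) U = (\<lambda>x. frechet_derivative (iter_partial is U) (at x) (axis i 1))"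

definition smooth_on :: "(real^3) set \<Rightarrow> (real^3 \<Rightarrow> real) \<Rightarrow> bool" where
  "smooth_on D U \<longleftrightarrow> (\<forall>is. iter_partial is U differentiable_on D)"

definition grad :: "(real^3 \<Rightarrow> real) \<Rightarrow> real^3 \<Rightarrow> real^3" where
  "grad U x = (\<chi> i. frechet_derivative U (at x) (axis i 1))"

definition rot3 :: "real \<Rightarrow> real^3^3" where
  "rot3 \<phi> = vector [vector [cos \<phi>, - sin \<phi>, 0],
                   vector [sin \<phi>, cos \<phi>, 0],
                   vector [0, 0, 1]]"

text \<open>
  The potential need only be defined on an open region \<open>D\<close> (for instance the exterior of the body).
  The region is itself a body of revolution about the third axis, so that the differential
  symmetry condition does imply that \<open>U\<close> depends on \<open>\<rho>\<close> and \<open>R\<^sub>3\<close> only.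
\<close>

definition axisymmetric_potential :: "(real^3) set \<Rightarrow> (real^3 \<Rightarrow> real) \<Rightarrow> bool" where
  "axisymmetric_potential D U \<longleftrightarrow>
     open D \<and> (\<forall>\<phi>. \<forall>R\<in>D. rot3 \<phi> *v R \<in> D) \<and> smooth_on D U \<and>
     (\<forall>R\<in>D. R$1 * grad U R $ 2 - R$2 * grad U R $ 1 = 0)"

definition axis_dist :: "real^3 \<Rightarrow> real" where
  "axis_dist R = sqrt ((R$1)\<^sup>2 + (R$2)\<^sup>2)"

text \<open>
  On \<open>D\<close> one has \<open>U(R) = u(\<rho>, R\<^sub>3)\<close> with the reduced potential \<open>u(s, h) = U(s, 0, h)\<close>;
  \<open>U\<^sub>\<rho>\<close> is the partial derivative of \<open>u\<close> in its first argument.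
\<close>

definition grad_rho :: "(real^3 \<Rightarrow> real) \<Rightarrow> real^3 \<Rightarrow> real" where
  "grad_rho U R = deriv (\<lambda>s. U (vector [s, 0, R$3])) (axis_dist R)"


section \<open>Motion in the body frame\<close>

definition inertia :: "real \<Rightarrow> real \<Rightarrow> real^3^3" where
  "inertia A C = vector [vector [A, 0, 0], vector [0, A, 0], vector [0, 0, C]]"

definition angular_velocity :: "real \<Rightarrow> real \<Rightarrow> real^3 \<Rightarrow> real^3" where
  "angular_velocity A C G = matrix_inv (inertia A C) *v G"

definition solves_eom ::
  "real \<Rightarrow> real \<Rightarrow> (real^3) set \<Rightarrow> (real^3 \<Rightarrow> real) \<Rightarrow>
   (real \<Rightarrow> real^3) \<Rightarrow> (real \<Rightarrow> real^3) \<Rightarrow> (real \<Rightarrow> real^3) \<Rightarrow> bool" where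
  "solves_eom A C D U R P G \<longleftrightarrow> (\<forall>t.
     R t \<in> D \<and>
     (R has_vector_derivative (R t \<times> angular_velocity A C (G t) + P t)) (at t) \<and>
     (P has_vector_derivative (P t \<times> angular_velocity A C (G t) - grad U (R t))) (at t) \<and>
     (G has_vector_derivative (G t \<times> angular_velocity A C (G t) + R t \<times> grad U (R t))) (at t))"

definition relative_equilibrium ::
  "real \<Rightarrow> real \<Rightarrow> (real^3) set \<Rightarrow> (real^3 \<Rightarrow> real) \<Rightarrow>
   real^3 \<Rightarrow> real^3 \<Rightarrow> real^3 \<Rightarrow> real \<Rightarrow> bool" where
  "relative_equilibrium A C D U R0 P0 G0 N \<longleftrightarrow>
     R0 \<noteq> 0 \<and>
     solves_eom A C D U (\<lambda>t. rot3 (N * t) *v R0) (\<lambda>t. rot3 (N * t) *v P0) (\<lambda>t. rot3 (N * t) *v G0)"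

definition locally_central :: "(real^3 \<Rightarrow> real) \<Rightarrow> real^3 \<Rightarrow> bool" where
  "locally_central U R0 \<longleftrightarrow> R0 \<times> grad U R0 = 0"


section \<open>Motion in the inertial frame\<close>

text \<open>
  \<open>Q t\<close> maps body-frame components to inertial components; \<open>\<Omega> t\<close> is the angular velocity of the
  body in body-frame components, so the derivative of \<open>Q\<close> applied to \<open>v\<close> is \<open>Q (\<Omega> \<times> v)\<close>.
\<close>

definition attitude :: "(real \<Rightarrow> real^3^3) \<Rightarrow> (real \<Rightarrow> real^3) \<Rightarrow> bool" where
  "attitude Q \<Omega> \<longleftrightarrow> (\<forall>t. rotation_matrix (Q t) \<and>
     (Q has_vector_derivative (Q t ** matrix (\<lambda>v. \<Omega> t \<times> v))) (at t))"

definition orbital_plane :: "(real \<Rightarrow> real^3) \<Rightarrow> (real^3) set" where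
  "orbital_plane x = affine hull (range x)"

text \<open>
  Non-Lagrangian: with the barycentre at rest in the origin and \<open>r\<close> pointing from the mass centre
  of the body (mass \<open>mb\<close>) to the point mass (mass \<open>mp\<close>), the two orbits are the following multiples
  of \<open>r\<close>.
\<close>

definition non_lagrangian :: "real \<Rightarrow> real \<Rightarrow> (real \<Rightarrow> real^3) \<Rightarrow> bool" where
  "non_lagrangian mp mb r \<longleftrightarrow>
     affine_parallel (orbital_plane (\<lambda>t. (mb / (mp + mb)) *\<^sub>R r t))
                     (orbital_plane (\<lambda>t. - (mp / (mp + mb)) *\<^sub>R r t)) \<and>
     orbital_plane (\<lambda>t. (mb / (mp + mb)) *\<^sub>R r t) \<noteq>
     orbital_plane (\<lambda>t. - (mp / (mp + mb)) *\<^sub>R r t)"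

definition perpendicular_to :: "real^3 \<Rightarrow> (real^3) set \<Rightarrow> bool" where
  "perpendicular_to v S \<longleftrightarrow> (\<forall>x\<in>S. \<forall>y\<in>S. v \<bullet> (x - y) = 0)"

definition parallel_to :: "real^3 \<Rightarrow> (real^3) set \<Rightarrow> bool" where
  "parallel_to v S \<longleftrightarrow> (\<forall>x\<in>S. x + v \<in> S)"

definition inclined_to :: "real^3 \<Rightarrow> (real^3) set \<Rightarrow> bool" where
  "inclined_to v S \<longleftrightarrow> \<not> perpendicular_to v S \<and> \<not> parallel_to v S"

end

theory Submission
  imports Defs
begin

text \<open>
  With \<open>V = \<Omega> + N e\<^sub>3\<close> a relative equilibrium is an algebraic system:
  \<open>P = V \<times> R\<close>, \<open>V \<times> P = - \<nabla>U\<close>, \<open>V \<times> G = R \<times> \<nabla>U\<close>. By symmetry the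
  horizontal part of \<open>\<nabla>U\<close> is parallel to that of \<open>R\<close>, and when the equilibrium is not locally
  central the last equation forces the horizontal part of \<open>\<Omega>\<close> to be \<open>\<kappa>\<close> times that of \<open>R\<close>.
  With \<open>d = V\<^sub>3 - \<kappa> R\<^sub>3\<close> everything is then polynomial in \<open>\<kappa>\<close>, \<open>d\<close> and \<open>\<rho>\<close>: \<open>U\<^sub>\<rho> = \<rho> V\<^sub>3 d\<close>,
  \<open>U\<^sub>3 = - \<kappa> \<rho>\<^sup>2 d\<close>, \<open>K = \<rho>\<^sup>2 d\<^sup>2\<close>.
  In the inertial frame the motion is a steady rotation about the image \<open>w\<close> of \<open>V\<close>, which is constant,
  and \<open>\<langle>w, r\<rangle> = \<langle>V, R\<rangle> = \<kappa> \<rho>\<^sup>2 + R\<^sub>3 V\<^sub>3 \<noteq> 0\<close> separates the two orbital planes.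
\<close>

section \<open>Axisymmetric potentials\<close>

lemma rot3_mult: "rot3 \<phi> *v x = vector [cos \<phi> * x$1 - sin \<phi> * x$2, sin \<phi> * x$1 + cos \<phi> * x$2, x$3]"
  by (simp add: rot3_def vec_eq_iff forall_3 matrix_vector_mult_def sum_3)

lemma rotation_matrix_rot3: "rotation_matrix (rot3 \<phi>)"
proof -
  have "sin \<phi> * sin \<phi> + cos \<phi> * cos \<phi> = 1" "cos \<phi> * cos \<phi> + sin \<phi> * sin \<phi> = 1"
    using sin_cos_squared_add[of \<phi>] by (simp_all add: power2_eq_square)
  then show ?thesis
    by (simp add: rotation_matrix_def orthogonal_matrix rot3_def det_3 vec_eq_iff forall_3
        matrix_matrix_mult_def transpose_def mat_def sum_3)
qed

lemma inner_rotation_matrix: "rotation_matrix B \<Longrightarrow> (B *v x) \<bullet> (B *v y) = x \<bullet> y"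
  for B :: "real^'n^'n"
  using orthogonal_transformation_matrix[of "(*v) B"]
  by (simp add: rotation_matrix_def orthogonal_transformation_def)

lemma rotation_matrix_eq_iff: "rotation_matrix B \<Longrightarrow> B *v x = B *v y \<longleftrightarrow> x = y"
  for B :: "real^'n^'n"
  by (metis inner_rotation_matrix inner_diff_left inner_eq_zero_iff matrix_vector_mult_diff_distrib eq_iff_diff_eq_0)

lemma rot3_inverse: "rot3 \<phi> *v (rot3 (- \<phi>) *v x) = x"
proof -
  have "sin \<phi> * sin \<phi> = 1 - cos \<phi> * cos \<phi>"
    using sin_cos_squared_add[of \<phi>] by (simp add: power2_eq_square)
  then have "sin \<phi> * (sin \<phi> * y) = y - cos \<phi> * (cos \<phi> * y)" for y
    by (metis mult.assoc mult.commute mult_1 left_diff_distrib)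
  then show ?thesis
    by (simp add: rot3_mult vec_eq_iff forall_3 ring_distribs mult.left_commute)
qed

text \<open>The derivative is kept as the rotation applied to a constant vector, so that in a
  relative equilibrium the rotation cancels from both sides of the equations of motion.\<close>

lemma has_vector_derivative_rot3:
  "((\<lambda>t. rot3 (N * t) *v x) has_vector_derivative rot3 (N * t) *v (N *\<^sub>R (vector [0, 0, 1] \<times> x))) (at t)"
proof -
  have eq: "rot3 a *v x = cos a *\<^sub>R vector [x$1, x$2, 0] + sin a *\<^sub>R vector [- x$2, x$1, 0] + vector [0, 0, x$3]" for a
    by (simp add: rot3_mult vec_eq_iff forall_3)
  have "((\<lambda>t. rot3 (N * t) *v x) has_vector_derivative
      (- (N * sin (N * t))) *\<^sub>R vector [x$1, x$2, 0] + (N * cos (N * t)) *\<^sub>R vector [- x$2, x$1, 0]) (at t)"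
    unfolding eq by (auto intro!: derivative_eq_intros simp: mult.commute)
  moreover have "(- (N * sin (N * t))) *\<^sub>R vector [x$1, x$2, 0] + (N * cos (N * t)) *\<^sub>R vector [- x$2, x$1, 0]
      = rot3 (N * t) *v (N *\<^sub>R (vector [0, 0, 1] \<times> x))"
    by (simp add: rot3_mult vec_eq_iff forall_3 cross3_def algebra_simps)
  ultimately show ?thesis by simp
qed

lemma has_derivative_grad:
  assumes "U differentiable (at x)"
  shows "(U has_derivative (\<lambda>h. grad U x \<bullet> h)) (at x)"
proof -
  let ?D = "frechet_derivative U (at x)"
  have D: "(U has_derivative ?D) (at x)"
    using assms by (simp add: frechet_derivative_works)
  then interpret bounded_linear ?D by (rule has_derivative_bounded_linear)
  have "?D h = grad U x \<bullet> h" for h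
  proof -
    have "h = h$1 *\<^sub>R axis 1 1 + h$2 *\<^sub>R axis 2 1 + h$3 *\<^sub>R axis 3 1"
      by (simp add: vec_eq_iff forall_3 axis_def)
    then have "?D h = ?D (h$1 *\<^sub>R axis 1 1 + h$2 *\<^sub>R axis 2 1 + h$3 *\<^sub>R axis 3 1)"
      by simp
    also have "\<dots> = grad U x \<bullet> h"
      unfolding add scaleR by (simp add: grad_def inner_vec_def sum_3)
    finally show ?thesis .
  qed
  then have "?D = (\<lambda>h. grad U x \<bullet> h)" by (rule ext)
  with D show ?thesis by simp
qed

context
  fixes U :: "real^3 \<Rightarrow> real" and D
  assumes U: "axisymmetric_potential D U"
begin

lemma potential_has_derivative: "R \<in> D \<Longrightarrow> (U has_derivative (\<lambda>h. grad U R \<bullet> h)) (at R)"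
proof -
  \<comment> \<open>The empty index list gives differentiability of \<open>U\<close> itself.\<close>
  have "iter_partial [] U differentiable_on D" "open D"
    using U unfolding axisymmetric_potential_def smooth_on_def by blast+
  then show "R \<in> D \<Longrightarrow> ?thesis"
    by (simp add: has_derivative_grad differentiable_on_eq_differentiable_at)
qed

lemma rot3_in_domain: "R \<in> D \<Longrightarrow> rot3 \<phi> *v R \<in> D"
  using U by (simp add: axisymmetric_potential_def)

text \<open>The symmetry condition makes the derivative of \<open>U\<close> vanish along each circle
  about the third axis, and a circle through a point of \<open>D\<close> stays in
  \<open>D\<close>.\<close>

lemma potential_rot3:
  assumes "R \<in> D"
  shows "U (rot3 \<phi> *v R) = U R"
proof -
  have "DERIV (\<lambda>\<phi>. U (rot3 \<phi> *v R)) t :> 0" for t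
  proof -
    let ?S = "rot3 t *v R"
    have S: "?S \<in> D" using assms by (rule rot3_in_domain)
    have "((\<lambda>\<phi>. rot3 \<phi> *v R) has_derivative (\<lambda>h. h *\<^sub>R (rot3 t *v (vector [0, 0, 1] \<times> R)))) (at t)"
      using has_vector_derivative_rot3[of 1 R t] by (simp add: has_vector_derivative_def)
    from has_derivative_compose[OF this potential_has_derivative[OF S]]
    have "((\<lambda>\<phi>. U (rot3 \<phi> *v R)) has_derivative
        (\<lambda>h. grad U ?S \<bullet> (h *\<^sub>R (rot3 t *v (vector [0, 0, 1] \<times> R))))) (at t)" .
    \<comment> \<open>The rotation fixes the third axis, so the velocity of the circle at
      \<open>?S\<close> is the cross product of that axis with \<open>?S\<close>.\<close>
    moreover have "grad U ?S \<bullet> (rot3 t *v (vector [0, 0, 1] \<times> R)) = ?S$1 * grad U ?S $ 2 - ?S$2 * grad U ?S $ 1"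
      by (simp add: inner_vec_def sum_3 cross3_def rot3_mult algebra_simps)
    moreover have "?S$1 * grad U ?S $ 2 - ?S$2 * grad U ?S $ 1 = 0"
      using U S by (simp add: axisymmetric_potential_def)
    ultimately show ?thesis
      by (simp add: has_field_derivative_def lambda_zero)
  qed
  then have "U (rot3 \<phi> *v R) = U (rot3 0 *v R)"
    using DERIV_isconst_all[of "\<lambda>\<phi>. U (rot3 \<phi> *v R)" \<phi> 0] by blast
  also have "rot3 0 *v R = R"
    by (simp add: rot3_mult vec_eq_iff forall_3)
  finally show ?thesis .
qed

text \<open>Differentiating the invariance of \<open>U\<close> under the rotation gives this by the
  chain rule, since the rotation preserves inner products.\<close>

lemma grad_rot3:
  assumes R: "R \<in> D"
  shows "grad U (rot3 \<phi> *v R) = rot3 \<phi> *v grad U R"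
proof -
  let ?B = "rot3 \<phi>"
  have S: "?B *v R \<in> D" using R by (rule rot3_in_domain)
  have "((\<lambda>x. ?B *v x) has_derivative (\<lambda>h. ?B *v h)) (at R)"
    by (rule bounded_linear_imp_has_derivative) simp
  from has_derivative_compose[OF this potential_has_derivative[OF S]]
  have "((\<lambda>x. U (?B *v x)) has_derivative (\<lambda>h. grad U (?B *v R) \<bullet> (?B *v h))) (at R)" .
  \<comment> \<open>Invariance holds on \<open>D\<close> only; since \<open>D\<close> is open, this
    suffices for the derivative at \<open>R\<close>.\<close>
  then have "(U has_derivative (\<lambda>h. grad U (?B *v R) \<bullet> (?B *v h))) (at R)"
    by (rule has_derivative_transform_within_open[of _ _ _ _ D])
      (use U R potential_rot3 in \<open>auto simp: axisymmetric_potential_def\<close>)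
  from has_derivative_unique[OF this potential_has_derivative[OF R]]
  have "grad U (?B *v R) \<bullet> (?B *v h) = (?B *v grad U R) \<bullet> (?B *v h)" for h
    by (simp add: fun_eq_iff inner_rotation_matrix rotation_matrix_rot3)
  from this[of "rot3 (- \<phi>) *v _"] have "grad U (?B *v R) \<bullet> h = (?B *v grad U R) \<bullet> h" for h
    by (simp add: rot3_inverse)
  then show ?thesis
    by (metis inner_commute vector_eq_ldot)
qed

text \<open>A half turn fixes the points of the axis and reverses the horizontal components of the
  gradient there.\<close>

lemma grad_on_axis:
  assumes "R \<in> D" "axis_dist R = 0"
  shows "grad U R $ 1 = 0" "grad U R $ 2 = 0"
proof -
  have "R$1 = 0" "R$2 = 0"
    using assms(2) by (simp_all add: axis_dist_def sum_power2_eq_zero_iff)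
  then have "rot3 pi *v R = R"
    by (simp add: rot3_mult vec_eq_iff forall_3)
  with grad_rot3[OF assms(1), of pi] have "grad U R = rot3 pi *v grad U R"
    by simp
  then show "grad U R $ 1 = 0" "grad U R $ 2 = 0"
    by (simp_all add: rot3_mult vec_eq_iff forall_3)
qed

text \<open>Rotate \<open>R\<close> to the point \<open>S\<close> of the meridian half-plane with
  the same height and distance from the axis. There the first component of the gradient is by
  definition \<open>grad_rho\<close> and the second vanishes by symmetry; rotating back distributes
  the radial derivative over the horizontal components.\<close>

lemma grad_cylindrical:
  assumes R: "R \<in> D" and \<rho>: "axis_dist R \<noteq> 0"
  shows "grad U R = vector [R$1 * (grad_rho U R / axis_dist R), R$2 * (grad_rho U R / axis_dist R), grad U R $ 3]"
proof -
  define r where "r = axis_dist R"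
  have r: "r > 0" "r\<^sup>2 = (R$1)\<^sup>2 + (R$2)\<^sup>2"
    using \<rho> by (simp_all add: r_def axis_dist_def less_le)
  have "(R$1 / r)\<^sup>2 + (R$2 / r)\<^sup>2 = 1"
    using r(1) unfolding power_divide add_divide_distrib[symmetric] r(2)[symmetric] by (simp add: power_divide add_divide_distrib[symmetric])
  then obtain \<phi> where \<phi>: "R$1 / r = cos \<phi>" "R$2 / r = sin \<phi>"
    using sincos_total_2pi by metis
  define S :: "real^3" where "S = vector [r, 0, R$3]"
  have S: "rot3 \<phi> *v S = R"
    using r \<phi>[symmetric] by (simp add: S_def rot3_mult vec_eq_iff forall_3)
  have "rot3 (- \<phi>) *v R = S"
    using rot3_inverse[of "- \<phi>" S] S by simp
  then have SD: "S \<in> D" using rot3_in_domain[OF R] by metis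
  have "((\<lambda>s. s *\<^sub>R vector [1, 0, 0] + vector [0, 0, R$3] :: real^3) has_derivative
      (\<lambda>h. h *\<^sub>R vector [1, 0, 0])) (at r)"
    by (auto intro!: derivative_eq_intros)
  moreover have "s *\<^sub>R vector [1, 0, 0] + vector [0, 0, R$3] = (vector [s, 0, R$3] :: real^3)" for s
    by (simp add: vec_eq_iff forall_3)
  ultimately have "((\<lambda>s. vector [s, 0, R$3] :: real^3) has_derivative (\<lambda>h. h *\<^sub>R vector [1, 0, 0])) (at r)"
    by simp
  from has_derivative_compose[OF this potential_has_derivative[OF SD, unfolded S_def]]
  have "((\<lambda>s. U (vector [s, 0, R$3])) has_derivative (\<lambda>h. grad U S \<bullet> (h *\<^sub>R vector [1, 0, 0]))) (at r)"
    by (simp add: S_def)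
  then have "((\<lambda>s. U (vector [s, 0, R$3])) has_field_derivative grad U S $ 1) (at r)"
    by (simp add: has_field_derivative_def inner_vec_def sum_3 mult_commute_abs)
  then have "grad_rho U R = grad U S $ 1"
    unfolding grad_rho_def r_def[symmetric] by (rule DERIV_imp_deriv)
  \<comment> \<open>At \<open>S\<close> the symmetry condition reduces to
    \<open>r * grad U S $ 2 = 0\<close>.\<close>
  moreover have "grad U S $ 2 = 0"
    using U SD r by (auto simp: axisymmetric_potential_def S_def)
  moreover have "grad U R = rot3 \<phi> *v grad U S"
    using grad_rot3[OF SD] S by metis
  ultimately show ?thesis
    using \<phi>[symmetric] by (simp add: rot3_mult vec_eq_iff forall_3 r_def)
qed

end

section \<open>Equilibrium equations\<close>

lemma angular_velocity_eq:
  assumes "A \<noteq> 0" "C \<noteq> 0"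
  shows "angular_velocity A C G = vector [G$1 / A, G$2 / A, G$3 / C]"
proof -
  let ?J = "inertia (1 / A) (1 / C)"
  have "inertia A C ** ?J = mat 1" "?J ** inertia A C = mat 1"
    using assms by (simp_all add: inertia_def vec_eq_iff forall_3 matrix_matrix_mult_def mat_def sum_3)
  then have "invertible (inertia A C)"
    unfolding invertible_def by blast
  \<comment> \<open>\<open>matrix_inv\<close> is a chosen two-sided inverse; its value is then
    recovered from uniqueness of inverses.\<close>
  then have "matrix_inv (inertia A C) ** inertia A C = mat 1"
    unfolding invertible_def matrix_inv_def by (rule someI2_ex) blast
  then have "matrix_inv (inertia A C) = ?J"
    by (metis \<open>inertia A C ** ?J = mat 1\<close> matrix_mul_assoc matrix_mul_lid matrix_mul_rid)
  then show ?thesis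
    by (simp add: angular_velocity_def inertia_def vec_eq_iff forall_3 matrix_vector_mult_def sum_3)
qed

text \<open>The two equal moments of inertia make the inertia tensor commute with rotations about
  the third axis.\<close>

lemma angular_velocity_rot3:
  assumes "A \<noteq> 0" "C \<noteq> 0"
  shows "angular_velocity A C (rot3 \<phi> *v G) = rot3 \<phi> *v angular_velocity A C G"
  using assms by (simp add: angular_velocity_eq rot3_mult vec_eq_iff forall_3 field_simps)

text \<open>Each term of the equations of motion is equivariant under rotations about the third
  axis. Cancelling the common rotation leaves the same algebraic system at every time, with the spin
  \<open>N\<close> about the third axis added to the angular velocity of the body.\<close>

lemma relative_equilibrium_iff:
  fixes A C :: real
  assumes AC: "A \<noteq> 0" "C \<noteq> 0" and U: "axisymmetric_potential D U"
    and V: "V = angular_velocity A C G + N *\<^sub>R vector [0, 0, 1]"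
  shows "relative_equilibrium A C D U R P G N \<longleftrightarrow>
    R \<noteq> 0 \<and> R \<in> D \<and> P = V \<times> R \<and> V \<times> P = - grad U R \<and> V \<times> G = R \<times> grad U R"
proof -
  let ?W = "angular_velocity A C G" and ?e = "vector [0, 0, 1] :: real^3"
  \<comment> \<open>Derivatives are unique and rotations are injective.\<close>
  have *: "((\<lambda>t. rot3 (N * t) *v x) has_vector_derivative rot3 (N * t) *v y) (at t)
      \<longleftrightarrow> N *\<^sub>R (?e \<times> x) = y" for x y t
    by (metis has_vector_derivative_rot3 vector_derivative_unique_at rotation_matrix_eq_iff rotation_matrix_rot3)
  have **: "N *\<^sub>R (?e \<times> x) = x \<times> ?W + y \<longleftrightarrow> V \<times> x = y" for x y
    by (simp add: V cross_add_left cross_mult_left cross_skew[of x ?W] algebra_simps eq_neg_iff_add_eq_0)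
  have ***: "N *\<^sub>R (?e \<times> x) = x \<times> ?W - y \<longleftrightarrow> V \<times> x = - y" for x y
    using **[of x "- y"] by simp
  have "(rot3 (N * t) *v R \<in> D \<and>
     ((\<lambda>t. rot3 (N * t) *v R) has_vector_derivative
        ((rot3 (N * t) *v R) \<times> angular_velocity A C (rot3 (N * t) *v G) + rot3 (N * t) *v P)) (at t) \<and>
     ((\<lambda>t. rot3 (N * t) *v P) has_vector_derivative
        ((rot3 (N * t) *v P) \<times> angular_velocity A C (rot3 (N * t) *v G) - grad U (rot3 (N * t) *v R))) (at t) \<and>
     ((\<lambda>t. rot3 (N * t) *v G) has_vector_derivative
        ((rot3 (N * t) *v G) \<times> angular_velocity A C (rot3 (N * t) *v G) + (rot3 (N * t) *v R) \<times> grad U (rot3 (N * t) *v R))) (at t))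
     \<longleftrightarrow> R \<in> D \<and> V \<times> R = P \<and> V \<times> P = - grad U R \<and> V \<times> G = R \<times> grad U R" for t
  proof -
    have "rot3 (N * t) *v R \<in> D \<longleftrightarrow> R \<in> D"
      by (metis U rot3_in_domain rot3_inverse minus_minus)
    then show ?thesis
      using AC
      by (auto simp: angular_velocity_rot3 grad_rot3[OF U] cross_rotation_matrix rotation_matrix_rot3
          matrix_vector_right_distrib[symmetric] matrix_vector_mult_diff_distrib[symmetric] * ** ***)
  qed
  then show ?thesis
    by (auto simp: relative_equilibrium_def solves_eom_def)
qed

section \<open>Parametrisation of the equilibria by \<open>\<kappa>\<close> and
  \<open>d\<close>\<close>

lemma not_locally_central_off_axis:
  assumes "axisymmetric_potential D U" "R \<in> D" "\<not> locally_central U R"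
  shows "axis_dist R \<noteq> 0"
proof
  assume axis: "axis_dist R = 0"
  then have "R$1 = 0" "R$2 = 0"
    by (simp_all add: axis_dist_def)
  \<comment> \<open>On the axis both \<open>R\<close> and the gradient are vertical, hence
    parallel.\<close>
  with grad_on_axis[OF assms(1,2) axis] assms(3) show False
    by (simp add: locally_central_def cross3_def vec_eq_iff forall_3)
qed

text \<open>The horizontal components of the torque equation say that \<open>n\<close> times the
  horizontal part of the angular velocity is \<open>- m\<close> times that of \<open>R0\<close>. Not
  being locally central means \<open>m \<noteq> 0\<close>, so \<open>n \<noteq> 0\<close> and
  \<open>\<kappa> = - m / n\<close>; the other two equations then express \<open>P0\<close> and the
  gradient through \<open>\<kappa>\<close> and \<open>d\<close>.\<close>

lemma not_locally_central_conic:
  fixes A C :: real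
  assumes A: "A > 0" and C: "C > 0" and U: "axisymmetric_potential D U"
    and eq: "relative_equilibrium A C D U R0 P0 G0 N" and nc: "\<not> locally_central U R0"
    and R0: "R0 = vector [R1, R2, R3]" and G0: "G0 = vector [A * W1, A * W2, C * W3]"
    and V3: "V3 = W3 + N"
    and \<rho>: "\<rho> = sqrt (R1\<^sup>2 + R2\<^sup>2)" and Ur: "Ur = grad_rho U R0" and U3: "U3 = grad U R0 $ 3"
  obtains \<kappa> d where "\<rho> > 0" "\<kappa> \<noteq> 0" "d \<noteq> 0" "d = V3 - \<kappa> * R3" "W1 = \<kappa> * R1" "W2 = \<kappa> * R2"
    "P0 = vector [- R2 * d, R1 * d, 0]" "Ur = \<rho> * V3 * d" "U3 = - \<kappa> * \<rho>\<^sup>2 * d"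
    "\<kappa> * (A * V3 - C * W3) = d * (\<kappa> * \<rho>\<^sup>2 + R3 * V3)" "\<kappa> * \<rho>\<^sup>2 + R3 * V3 \<noteq> 0"
proof -
  let ?V = "vector [W1, W2, V3] :: real^3"
  have V: "?V = angular_velocity A C G0 + N *\<^sub>R vector [0, 0, 1]"
    using A C by (simp add: angular_velocity_eq G0 V3 vec_eq_iff forall_3)
  have R0D: "R0 \<in> D" and P0: "P0 = ?V \<times> R0" and VP: "?V \<times> P0 = - grad U R0"
    and VG: "?V \<times> G0 = R0 \<times> grad U R0"
    using eq relative_equilibrium_iff[OF _ _ U V] A C by auto
  have axis_dist: "axis_dist R0 = \<rho>"
    by (simp add: axis_dist_def R0 \<rho>)
  have "\<rho> \<noteq> 0"
    using not_locally_central_off_axis[OF U R0D nc] axis_dist by simp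
  then have \<rho>_pos: "\<rho> > 0" by (simp add: \<rho> less_le)
  have \<rho>2: "\<rho>\<^sup>2 = R1\<^sup>2 + R2\<^sup>2" by (simp add: \<rho>)
  define u where "u = Ur / \<rho>"
  \<comment> \<open>\<open>m\<close> is the common factor of the components of
    \<open>R0 \<times> grad U R0\<close>.\<close>
  define m where "m = U3 - R3 * u"
  define n where "n = A * V3 - C * W3"
  have g: "grad U R0 = vector [R1 * u, R2 * u, U3]"
    using grad_cylindrical[OF U R0D] \<open>\<rho> \<noteq> 0\<close> unfolding axis_dist
    by (simp add: R0[symmetric] u_def Ur U3) (simp add: R0)
  have n: "n * W1 = - (R1 * m)" "n * W2 = - (R2 * m)"
    using VG unfolding g by (simp_all add: cross3_def vec_eq_iff forall_3 R0 G0 n_def m_def algebra_simps)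
  have m: "m \<noteq> 0"
  proof
    assume "m = 0"
    then have "R0 \<times> grad U R0 = 0"
      unfolding g unfolding R0 by (simp add: cross3_def vec_eq_iff forall_3 m_def)
    with nc show False by (simp add: locally_central_def)
  qed
  have R12: "R1 \<noteq> 0 \<or> R2 \<noteq> 0"
    using \<open>\<rho> \<noteq> 0\<close> by (auto simp: \<rho>)
  have n0: "n \<noteq> 0" using n m R12 by auto
  define \<kappa> where "\<kappa> = - m / n"
  define d where "d = V3 - \<kappa> * R3"
  have W: "W1 = \<kappa> * R1" "W2 = \<kappa> * R2"
    using n n0 by (simp_all add: \<kappa>_def field_simps)
  have "R1 * (V3 * d) = R1 * u" "R2 * (V3 * d) = R2 * u" and U3': "U3 = - \<kappa> * (R1\<^sup>2 + R2\<^sup>2) * d"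
    using VP unfolding g by (simp_all add: P0 cross3_def vec_eq_iff forall_3 R0 W d_def algebra_simps power2_eq_square)
  with R12 have u: "u = V3 * d" by auto
  \<comment> \<open>This factorisation turns \<open>m \<noteq> 0\<close> into the non-vanishing of
    both factors.\<close>
  have m': "m = - (d * (\<kappa> * \<rho>\<^sup>2 + R3 * V3))"
    by (simp add: m_def u U3' \<rho>2 algebra_simps)
  show thesis
  proof (rule that[of \<kappa> d])
    show "Ur = \<rho> * V3 * d" using u \<open>\<rho> \<noteq> 0\<close> by (simp add: u_def field_simps)
    show "P0 = vector [- R2 * d, R1 * d, 0]"
      by (simp add: P0 cross3_def vec_eq_iff forall_3 R0 W d_def algebra_simps)
    show "\<kappa> * (A * V3 - C * W3) = d * (\<kappa> * \<rho>\<^sup>2 + R3 * V3)"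
      using m' n0 by (simp add: \<kappa>_def n_def[symmetric])
    show "\<kappa> \<noteq> 0" using m n0 by (simp add: \<kappa>_def)
    show "d \<noteq> 0" "\<kappa> * \<rho>\<^sup>2 + R3 * V3 \<noteq> 0" using m unfolding m' by simp_all
    show "U3 = - \<kappa> * \<rho>\<^sup>2 * d" using U3' by (simp only: \<rho>2)
  qed (rule \<rho>_pos d_def W)+
qed

text \<open>Converse of the parametrisation: any \<open>\<kappa>\<close>, \<open>d\<close>
  fulfilling these scalar relations yield an equilibrium, which supplies existence for given
  \<open>L\<close> and \<open>W3\<close>.\<close>

lemma conic_relative_equilibrium:
  fixes A C :: real
  assumes A: "A > 0" and C: "C > 0" and U: "axisymmetric_potential D U"
    and R0D: "R0 \<in> D" and R0: "R0 = vector [R1, R2, R3]"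
    and \<rho>: "\<rho> = sqrt (R1\<^sup>2 + R2\<^sup>2)" "\<rho> \<noteq> 0"
    and Ur: "grad_rho U R0 = \<rho> * V3 * d" and U3: "grad U R0 $ 3 = - \<kappa> * \<rho>\<^sup>2 * d"
    and d: "d = V3 - \<kappa> * R3"
    and n: "\<kappa> * (A * V3 - C * W3) = d * (\<kappa> * \<rho>\<^sup>2 + R3 * V3)"
  shows "relative_equilibrium A C D U R0 (vector [- R2 * d, R1 * d, 0])
    (vector [A * (\<kappa> * R1), A * (\<kappa> * R2), C * W3]) (V3 - W3)"
proof -
  let ?V = "vector [\<kappa> * R1, \<kappa> * R2, V3] :: real^3"
  let ?P = "vector [- R2 * d, R1 * d, 0] :: real^3"
  let ?G = "vector [A * (\<kappa> * R1), A * (\<kappa> * R2), C * W3] :: real^3"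
  have V: "?V = angular_velocity A C ?G + (V3 - W3) *\<^sub>R vector [0, 0, 1]"
    using A C by (simp add: angular_velocity_eq vec_eq_iff forall_3)
  have \<rho>2: "\<rho>\<^sup>2 = R1\<^sup>2 + R2\<^sup>2" by (simp add: \<rho>)
  have axis_dist: "axis_dist R0 = \<rho>"
    by (simp add: axis_dist_def R0 \<rho>)
  have g: "grad U R0 = vector [R1 * (V3 * d), R2 * (V3 * d), - \<kappa> * \<rho>\<^sup>2 * d]"
    using grad_cylindrical[OF U R0D] \<rho>(2) unfolding axis_dist Ur U3 by (simp add: R0)
  \<comment> \<open>The horizontal components of the torque equation are the relation
    \<open>n\<close> multiplied by \<open>R1\<close> and by \<open>R2\<close>.\<close>
  have nR: "R * (\<kappa> * (A * V3 - C * W3)) = R * (d * (\<kappa> * \<rho>\<^sup>2 + R3 * V3))" for R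
    by (simp add: n)
  have "R0 \<noteq> 0" using \<rho> by (auto simp: R0 vec_eq_iff forall_3)
  moreover have "?P = ?V \<times> R0"
    by (simp add: cross3_def vec_eq_iff forall_3 R0 d algebra_simps)
  moreover have "?V \<times> ?P = - grad U R0"
    by (simp add: cross3_def vec_eq_iff forall_3 g \<rho>2) (simp add: algebra_simps power2_eq_square)
  moreover have "?V \<times> ?G = R0 \<times> grad U R0"
    unfolding g using nR[of R1] nR[of R2]
    by (simp add: cross3_def vec_eq_iff forall_3 R0 algebra_simps)
  ultimately show ?thesis
    using A C R0D by (simp add: relative_equilibrium_iff[OF _ _ U V])
qed

text \<open>After substituting for \<open>Ur\<close>, \<open>U3\<close> and \<open>K\<close>, each
  claim is a rational identity in \<open>\<rho>\<close>, \<open>\<kappa>\<close>, \<open>d\<close>,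
  \<open>R3\<close> modulo \<open>n\<close>. As \<open>n\<close> is linear in \<open>W3\<close>, it
  eliminates \<open>W3\<close> once a factor \<open>\<kappa>\<close> has been split off.\<close>

lemma conic_relations:
  fixes A C :: real
  assumes nz: "\<rho> \<noteq> 0" "\<kappa> \<noteq> 0" "d \<noteq> 0" and d: "d = V3 - \<kappa> * R3"
    and Ur: "Ur = \<rho> * V3 * d" and U3: "U3 = - \<kappa> * \<rho>\<^sup>2 * d" and K: "K = \<rho> * Ur + R3 * U3"
    and n: "\<kappa> * (A * V3 - C * W3) = d * (\<kappa> * \<rho>\<^sup>2 + R3 * V3)"
    and L: "L2 = \<rho>\<^sup>2 * (A * \<kappa> - R3 * d)\<^sup>2 + (\<rho>\<^sup>2 * d + C * W3)\<^sup>2"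
  shows "K = \<rho>\<^sup>2 * d\<^sup>2" "K * V3\<^sup>2 = Ur\<^sup>2"
    "(A * V3 - C * W3) * Ur * U3 = K * (\<rho> * U3 - R3 * Ur) * V3"
    "V3 * (A * \<kappa> - R3 * d) = \<kappa> * (\<rho>\<^sup>2 * d + C * W3)"
    "V3 \<noteq> 0 \<Longrightarrow> L2 = ((A + R3\<^sup>2) * U3 + \<rho> * R3 * Ur)\<^sup>2 / K + (\<rho> * Ur / V3 + C * W3)\<^sup>2"
    "L2 * U3\<^sup>2 * K = (Ur\<^sup>2 + U3\<^sup>2) * (A * U3 + R3 * K)\<^sup>2"
    "C\<^sup>2 * W3\<^sup>2 * U3\<^sup>2 * K = (A * Ur * U3 + K * (R3 * Ur - \<rho> * U3))\<^sup>2"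
    "\<kappa> * (A * \<kappa> * \<rho>\<^sup>2 + C * W3 * R3) = (\<kappa> * \<rho>\<^sup>2 + R3 * V3) * (A * \<kappa> - R3 * d)"
    "V3 \<noteq> 0 \<Longrightarrow> A * \<kappa> * \<rho>\<^sup>2 + C * W3 * R3 = Ur * (A * U3 + R3 * K) / (U3 * K * V3) * (R3 * Ur - \<rho> * U3)"
proof -
  have V3: "V3 = d + \<kappa> * R3" using d by simp
  show K': "K = \<rho>\<^sup>2 * d\<^sup>2"
    unfolding K Ur U3 V3 by algebra
  show "K * V3\<^sup>2 = Ur\<^sup>2"
    unfolding K' Ur by algebra
  show "(A * V3 - C * W3) * Ur * U3 = K * (\<rho> * U3 - R3 * Ur) * V3"
  proof -
    \<comment> \<open>The factor in front is \<open>Ur * U3\<close> divided by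
      \<open>\<kappa>\<close>; it exposes the left side of \<open>n\<close>.\<close>
    have "(A * V3 - C * W3) * Ur * U3 = - (\<rho>^3 * V3 * d\<^sup>2) * (\<kappa> * (A * V3 - C * W3))"
      unfolding Ur U3 by algebra
    also have "\<dots> = K * (\<rho> * U3 - R3 * Ur) * V3"
      unfolding n K' Ur U3 by algebra
    finally show ?thesis .
  qed
  have CW: "\<kappa> * (C * W3) = A * V3 * \<kappa> - d * (\<kappa> * \<rho>\<^sup>2 + R3 * V3)"
    using n by (simp add: algebra_simps)
  \<comment> \<open>Geometrically: the total angular momentum is parallel to the angular velocity
    \<open>V\<close>.\<close>
  show vert: "V3 * (A * \<kappa> - R3 * d) = \<kappa> * (\<rho>\<^sup>2 * d + C * W3)"
    unfolding distrib_left CW by algebra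
  show "L2 = ((A + R3\<^sup>2) * U3 + \<rho> * R3 * Ur)\<^sup>2 / K + (\<rho> * Ur / V3 + C * W3)\<^sup>2" if "V3 \<noteq> 0"
  proof -
    have "(A + R3\<^sup>2) * U3 + \<rho> * R3 * Ur = - (\<rho>\<^sup>2 * d * (A * \<kappa> - R3 * d))"
      unfolding Ur U3 V3 by algebra
    moreover have "\<rho> * Ur / V3 = \<rho>\<^sup>2 * d"
      using that by (simp add: Ur power2_eq_square)
    ultimately show ?thesis
      using nz by (simp add: L K' power_mult_distrib power2_eq_square)
  qed
  show "L2 * U3\<^sup>2 * K = (Ur\<^sup>2 + U3\<^sup>2) * (A * U3 + R3 * K)\<^sup>2"
  proof -
    \<comment> \<open>The factor \<open>\<kappa>\<^sup>2\<close> of \<open>U3\<^sup>2\<close> is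
      moved into the squares so that \<open>vert\<close> replaces the vertical part of the angular
      momentum.\<close>
    have "L2 * U3\<^sup>2 * K = \<rho>^6 * d^4 * (\<rho>\<^sup>2 * \<kappa>\<^sup>2 * (A * \<kappa> - R3 * d)\<^sup>2 + (\<kappa> * (\<rho>\<^sup>2 * d + C * W3))\<^sup>2)"
      unfolding L U3 K' by algebra
    also have "\<dots> = (Ur\<^sup>2 + U3\<^sup>2) * (A * U3 + R3 * K)\<^sup>2"
      unfolding vert[symmetric] Ur U3 K' by algebra
    finally show ?thesis .
  qed
  show "C\<^sup>2 * W3\<^sup>2 * U3\<^sup>2 * K = (A * Ur * U3 + K * (R3 * Ur - \<rho> * U3))\<^sup>2"
  proof -
    have "C\<^sup>2 * W3\<^sup>2 * U3\<^sup>2 * K = (\<rho>^3 * d\<^sup>2 * (\<kappa> * (C * W3)))\<^sup>2"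
      unfolding U3 K' by algebra
    also have "\<dots> = (A * Ur * U3 + K * (R3 * Ur - \<rho> * U3))\<^sup>2"
      unfolding CW Ur U3 K' by algebra
    finally show ?thesis .
  qed
  \<comment> \<open>The inner product of \<open>R0\<close> with the parallel vectors of
    \<open>vert\<close>: the angular momentum contributes \<open>\<langle>G0, R0\<rangle>\<close>,
    and \<open>V\<close> contributes the last-but-one factor.\<close>
  show GR: "\<kappa> * (A * \<kappa> * \<rho>\<^sup>2 + C * W3 * R3) = (\<kappa> * \<rho>\<^sup>2 + R3 * V3) * (A * \<kappa> - R3 * d)"
  proof -
    have "\<kappa> * (A * \<kappa> * \<rho>\<^sup>2 + C * W3 * R3) = A * \<kappa>\<^sup>2 * \<rho>\<^sup>2 + \<kappa> * (C * W3) * R3"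
      by algebra
    also have "\<dots> = (\<kappa> * \<rho>\<^sup>2 + R3 * V3) * (A * \<kappa> - R3 * d)"
      unfolding CW by algebra
    finally show ?thesis .
  qed
  show "A * \<kappa> * \<rho>\<^sup>2 + C * W3 * R3 = Ur * (A * U3 + R3 * K) / (U3 * K * V3) * (R3 * Ur - \<rho> * U3)"
    if "V3 \<noteq> 0"
  proof -
    have 1: "Ur * (A * U3 + R3 * K) * (R3 * Ur - \<rho> * U3)
        = - (\<rho>^4 * d^3 * V3 * ((\<kappa> * \<rho>\<^sup>2 + R3 * V3) * (A * \<kappa> - R3 * d)))"
      unfolding Ur U3 K' by algebra
    have "Ur * (A * U3 + R3 * K) * (R3 * Ur - \<rho> * U3) = (A * \<kappa> * \<rho>\<^sup>2 + C * W3 * R3) * (U3 * K * V3)"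
      unfolding 1 GR[symmetric] unfolding U3 K' by algebra
    then show ?thesis
      using that nz by (simp add: U3 K' field_simps)
  qed
qed

lemma conic_angular_momentum:
  fixes A C :: real
  assumes \<rho>: "\<rho>\<^sup>2 = R1\<^sup>2 + R2\<^sup>2"
    and l_def: "l = vector [R1, R2, R3] \<times> vector [- R2 * d, R1 * d, 0] + vector [A * (\<kappa> * R1), A * (\<kappa> * R2), C * W3]"
  shows "l = vector [(A * \<kappa> - R3 * d) * R1, (A * \<kappa> - R3 * d) * R2, \<rho>\<^sup>2 * d + C * W3]"
    and "(norm l)\<^sup>2 = \<rho>\<^sup>2 * (A * \<kappa> - R3 * d)\<^sup>2 + (\<rho>\<^sup>2 * d + C * W3)\<^sup>2"
proof -
  show l: "l = vector [(A * \<kappa> - R3 * d) * R1, (A * \<kappa> - R3 * d) * R2, \<rho>\<^sup>2 * d + C * W3]"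
    by (simp add: l_def cross3_def vec_eq_iff forall_3 \<rho>) (simp add: algebra_simps power2_eq_square)
  show "(norm l)\<^sup>2 = \<rho>\<^sup>2 * (A * \<kappa> - R3 * d)\<^sup>2 + (\<rho>\<^sup>2 * d + C * W3)\<^sup>2"
    unfolding power2_norm_eq_inner l inner_vec_def sum_3 unfolding \<rho>
    by (simp, algebra)
qed

text \<open>For fixed \<open>R0\<close> and \<open>W3\<close> all data are functions of
  \<open>V3\<close>, and \<open>V3\<close> is known up to sign; two equilibria can thus be compared
  through their values of \<open>V3\<close>.\<close>

lemma conic_determined:
  fixes A C :: real
  assumes A: "A > 0" and C: "C > 0" and U: "axisymmetric_potential D U"
    and eq: "relative_equilibrium A C D U R0 P0 G0 (V3 - W3)" and nc: "\<not> locally_central U R0"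
    and R0: "R0 = vector [R1, R2, R3]" and G03: "G0 $ 3 = C * W3"
    and \<rho>: "\<rho> = sqrt (R1\<^sup>2 + R2\<^sup>2)" and Ur: "Ur = grad_rho U R0" and U3: "U3 = grad U R0 $ 3"
    and K: "K = \<rho> * Ur + R3 * U3" and nz: "R3 \<noteq> 0" "Ur \<noteq> 0"
  shows "K * V3\<^sup>2 = Ur\<^sup>2" "(A * V3 - C * W3) * Ur * U3 = K * (\<rho> * U3 - R3 * Ur) * V3" "K \<noteq> 0" "U3 \<noteq> 0"
    "P0 = vector [- R2 * (Ur / (V3 * \<rho>)), R1 * (Ur / (V3 * \<rho>)), 0]"
    "G0 = vector [A * (R1 * ((\<rho> * V3\<^sup>2 - Ur) / (\<rho> * R3 * V3))),
                  A * (R2 * ((\<rho> * V3\<^sup>2 - Ur) / (\<rho> * R3 * V3))), C * W3]"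
proof -
  have G0: "G0 = vector [A * (G0$1 / A), A * (G0$2 / A), C * W3]"
    using A by (simp add: vec_eq_iff forall_3 G03)
  have V3: "V3 = W3 + (V3 - W3)" by simp
  obtain \<kappa> d where \<rho>_pos: "\<rho> > 0" and \<kappa>d: "\<kappa> \<noteq> 0" "d \<noteq> 0" and d: "d = V3 - \<kappa> * R3"
    and W: "G0$1 / A = \<kappa> * R1" "G0$2 / A = \<kappa> * R2"
    and P0: "P0 = vector [- R2 * d, R1 * d, 0]" and Ur': "Ur = \<rho> * V3 * d" and U3': "U3 = - \<kappa> * \<rho>\<^sup>2 * d"
    and n: "\<kappa> * (A * V3 - C * W3) = d * (\<kappa> * \<rho>\<^sup>2 + R3 * V3)"
    by (rule not_locally_central_conic[OF A C U eq nc R0 G0 V3 \<rho> Ur U3])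
  have \<rho>0: "\<rho> \<noteq> 0" using \<rho>_pos by simp
  note rel = conic_relations[OF \<rho>0 \<kappa>d d Ur' U3' K n refl]
  show "K * V3\<^sup>2 = Ur\<^sup>2" "(A * V3 - C * W3) * Ur * U3 = K * (\<rho> * U3 - R3 * Ur) * V3"
    by (rule rel)+
  show "K \<noteq> 0" "U3 \<noteq> 0"
    using \<kappa>d \<rho>0 rel(1) U3' by simp_all
  have V30: "V3 \<noteq> 0" using nz Ur' by auto
  have "Ur / (V3 * \<rho>) = d"
    using V30 \<rho>0 by (simp add: Ur')
  then show "P0 = vector [- R2 * (Ur / (V3 * \<rho>)), R1 * (Ur / (V3 * \<rho>)), 0]"
    by (simp add: P0)
  have "\<rho> * V3\<^sup>2 - Ur = \<rho> * V3 * (\<kappa> * R3)"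
    by (simp add: Ur' d algebra_simps power2_eq_square)
  then have "(\<rho> * V3\<^sup>2 - Ur) / (\<rho> * R3 * V3) = \<kappa>"
    using V30 \<rho>0 nz by simp
  then show "G0 = vector [A * (R1 * ((\<rho> * V3\<^sup>2 - Ur) / (\<rho> * R3 * V3))),
                  A * (R2 * ((\<rho> * V3\<^sup>2 - Ur) / (\<rho> * R3 * V3))), C * W3]"
    using G0 W by (simp add: mult.commute)
qed

text \<open>The two equations only fix \<open>V3\<^sup>2\<close>; the sign of \<open>V3\<close> is chosen so that the unsquared
  relation between \<open>V3\<close> and \<open>W3\<close> holds.\<close>

lemma conic_solution:
  fixes A C :: real
  assumes nz: "\<rho> > 0" "R3 \<noteq> 0" "Ur \<noteq> 0" "L > 0" "A > 0" and K: "K = \<rho> * Ur + R3 * U3"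
    and L: "L\<^sup>2 * U3\<^sup>2 * K = (Ur\<^sup>2 + U3\<^sup>2) * (A * U3 + R3 * K)\<^sup>2"
    and W: "C\<^sup>2 * W3\<^sup>2 * U3\<^sup>2 * K = (A * Ur * U3 + K * (R3 * Ur - \<rho> * U3))\<^sup>2"
  obtains V3 \<kappa> d where "V3 \<noteq> 0" "K * V3\<^sup>2 = Ur\<^sup>2" "\<kappa> \<noteq> 0" "d \<noteq> 0" "d = V3 - \<kappa> * R3"
    "d = Ur / (V3 * \<rho>)" "\<kappa> = (\<rho> * V3\<^sup>2 - Ur) / (\<rho> * R3 * V3)"
    "Ur = \<rho> * V3 * d" "U3 = - \<kappa> * \<rho>\<^sup>2 * d" "\<kappa> * (A * V3 - C * W3) = d * (\<kappa> * \<rho>\<^sup>2 + R3 * V3)"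
proof -
  have U30: "U3 \<noteq> 0"
  proof
    assume "U3 = 0"
    with L nz have "K = 0" by simp
    with K \<open>U3 = 0\<close> nz show False by simp
  qed
  \<comment> \<open>With \<open>K = 0\<close> the equation \<open>L\<close> would leave a positive
    multiple of \<open>(A * U3)\<^sup>2\<close> equal to zero.\<close>
  have "K \<noteq> 0"
    using L nz U30 by auto
  \<comment> \<open>The right side of the equation \<open>L\<close> is a product of sums of squares,
    which fixes the sign of \<open>K\<close>.\<close>
  moreover have "L\<^sup>2 * U3\<^sup>2 * K \<ge> 0" unfolding L by simp
  moreover have "L\<^sup>2 * U3\<^sup>2 > 0" using nz U30 by simp
  ultimately have K_pos: "K > 0"
    using zero_le_mult_iff[of "L\<^sup>2 * U3\<^sup>2" K] by linarith
  define E where "E = A * Ur * U3 + K * (R3 * Ur - \<rho> * U3)"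
  define V where "V = Ur / sqrt K"
  have V: "K * V\<^sup>2 = Ur\<^sup>2" "V \<noteq> 0"
    using K_pos nz by (simp_all add: V_def power_divide)
  \<comment> \<open>Multiplying the equation \<open>W\<close> by \<open>V\<^sup>2\<close> removes
    \<open>K\<close>, so that square roots can be taken on both sides.\<close>
  have "(C * W3 * Ur * U3)\<^sup>2 = (C\<^sup>2 * W3\<^sup>2 * U3\<^sup>2) * Ur\<^sup>2"
    by algebra
  also have "\<dots> = (C\<^sup>2 * W3\<^sup>2 * U3\<^sup>2 * K) * V\<^sup>2"
    unfolding V(1)[symmetric] by algebra
  also have "\<dots> = (V * E)\<^sup>2"
    unfolding W E_def by algebra
  finally have "C * W3 * Ur * U3 = V * E \<or> C * W3 * Ur * U3 = - (V * E)"
    by (simp add: power2_eq_iff)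
  then obtain V3 where "V3 = V \<or> V3 = - V" and E: "C * W3 * Ur * U3 = V3 * E"
    by (metis minus_mult_left)
  with V have V3: "V3 \<noteq> 0" "K * V3\<^sup>2 = Ur\<^sup>2" by auto
  define \<kappa> where "\<kappa> = (\<rho> * V3\<^sup>2 - Ur) / (\<rho> * R3 * V3)"
  define d where "d = Ur / (V3 * \<rho>)"
  have d: "d = V3 - \<kappa> * R3" and d0: "d \<noteq> 0" and Ur: "Ur = \<rho> * V3 * d"
    using nz V3(1) by (simp_all add: \<kappa>_def d_def field_simps power2_eq_square)
  have "K * V3\<^sup>2 = \<rho>\<^sup>2 * d\<^sup>2 * V3\<^sup>2"
    unfolding V3(2) Ur by algebra
  then have K': "K = \<rho>\<^sup>2 * d\<^sup>2"
    using V3(1) by simp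
  \<comment> \<open>The two expressions for \<open>K\<close> determine \<open>R3 * U3\<close>;
    \<open>R3 \<noteq> 0\<close> then gives \<open>U3\<close>.\<close>
  have "R3 * U3 = R3 * (- \<kappa> * \<rho>\<^sup>2 * d)"
  proof -
    have "R3 * U3 = \<rho>\<^sup>2 * d\<^sup>2 - \<rho> * Ur" using K K' by simp
    also have "\<dots> = \<rho>\<^sup>2 * d * (d - V3)" unfolding Ur by algebra
    also have "\<dots> = R3 * (- \<kappa> * \<rho>\<^sup>2 * d)" by (simp add: d)
    finally show ?thesis .
  qed
  then have U3: "U3 = - \<kappa> * \<rho>\<^sup>2 * d"
    by (rule mult_left_cancel[OF nz(2), THEN iffD1])
  \<comment> \<open>The nonzero factor times \<open>\<kappa>\<close> is \<open>- Ur * U3\<close>,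
    which brings in the unsquared relation \<open>E\<close>.\<close>
  have "(\<rho>^3 * V3 * d\<^sup>2) * (\<kappa> * (A * V3 - C * W3)) = - (A * V3 * Ur * U3) + C * W3 * Ur * U3"
    unfolding Ur U3 by algebra
  also have "\<dots> = (\<rho>^3 * V3 * d\<^sup>2) * (d * (\<kappa> * \<rho>\<^sup>2 + R3 * V3))"
    unfolding E E_def unfolding Ur U3 K' by algebra
  finally have n: "\<kappa> * (A * V3 - C * W3) = d * (\<kappa> * \<rho>\<^sup>2 + R3 * V3)"
    using nz V3 d0 by simp
  show thesis
    by (rule that[OF V3 _ d0 d d_def \<kappa>_def Ur U3 n]) (use U30 U3 in auto)
qed

section \<open>Motion in the inertial frame\<close>

lemma bounded_bilinear_matrix_vector_mult: "bounded_bilinear ((*v) :: real^'n^'m \<Rightarrow> _)"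
  unfolding bilinear_conv_bounded_bilinear[symmetric] bilinear_def
  by (auto intro!: linearI simp: matrix_vector_right_distrib matrix_vector_mult_add_rdistrib
      scaleR_matrix_vector_assoc matrix_vector_mult_scaleR)

lemma matrix_cross: "matrix (\<lambda>v. w \<times> v) *v x = w \<times> x"
  using bilinear_cross by (auto simp: bilinear_def intro!: matrix_works)

text \<open>By the product rule the attitude contributes the body's angular velocity and the
  rotation contributes its spin. Both act inside the same rotation because the angular velocity
  turns along with \<open>x\<close>.\<close>

lemma has_vector_derivative_attitude_rot3:
  assumes Q: "attitude Q (\<lambda>t. rot3 (N * t) *v W)"
  shows "((\<lambda>t. Q t *v (rot3 (N * t) *v x)) has_vector_derivative
    Q t *v (rot3 (N * t) *v ((W + N *\<^sub>R vector [0, 0, 1]) \<times> x))) (at t)"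
proof -
  have "(Q has_vector_derivative (Q t ** matrix (\<lambda>v. (rot3 (N * t) *v W) \<times> v))) (at t)"
    using Q by (simp add: attitude_def)
  from bounded_bilinear.has_vector_derivative[OF bounded_bilinear_matrix_vector_mult
      this has_vector_derivative_rot3[of N x t]]
  show ?thesis
    by (simp add: matrix_cross cross_rotation_matrix rotation_matrix_rot3 cross_add_left cross_mult_left
        matrix_vector_right_distrib matrix_vector_mul_assoc[symmetric] add.commute)
qed

text \<open>A normal to the affine hull has constant inner product with the orbit; differentiating
  twice makes it orthogonal to the acceleration.\<close>

lemma perpendicular_orbital_plane:
  assumes r: "\<And>t. (r has_vector_derivative r' t) (at t)"
    and r': "(r' has_vector_derivative a) (at s)"
    and perp: "perpendicular_to v (orbital_plane r)"
  shows "v \<bullet> a = 0"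
proof -
  have "r t \<in> orbital_plane r" for t
    by (simp add: orbital_plane_def hull_inc)
  then have const: "v \<bullet> r t = v \<bullet> r 0" for t
    using perp by (force simp: perpendicular_to_def inner_diff_right)
  have "v \<bullet> r' t = 0" for t
  proof -
    have "((\<lambda>t. v \<bullet> r t) has_vector_derivative v \<bullet> r' t) (at t)"
      by (rule bounded_linear.has_vector_derivative[OF bounded_linear_inner_right r])
    then have "((\<lambda>t. v \<bullet> r 0) has_vector_derivative v \<bullet> r' t) (at t)"
      by (subst (asm) const)
    then show ?thesis
      by (rule vector_derivative_unique_at) (rule has_vector_derivative_const)
  qed
  moreover have "((\<lambda>t. v \<bullet> r' t) has_vector_derivative v \<bullet> a) (at s)"
    by (rule bounded_linear.has_vector_derivative[OF bounded_linear_inner_right r'])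
  ultimately have "((\<lambda>t. 0) has_vector_derivative v \<bullet> a) (at s)"
    by simp
  then show ?thesis
    by (rule vector_derivative_unique_at) (rule has_vector_derivative_const)
qed

lemma inner_orbital_plane:
  assumes "\<And>t. w \<bullet> r t = c" and "x \<in> orbital_plane r"
  shows "w \<bullet> x = c"
proof -
  have "orbital_plane r \<subseteq> {x. w \<bullet> x = c}"
    unfolding orbital_plane_def by (rule hull_minimal) (use assms(1) in \<open>auto simp: affine_hyperplane\<close>)
  with assms(2) show ?thesis by blast
qed

lemma parallel_orbital_plane:
  assumes "\<And>t. w \<bullet> r t = c" and "parallel_to v (orbital_plane r)"
  shows "w \<bullet> v = 0"
proof -
  have r: "r 0 \<in> orbital_plane r"
    by (simp add: orbital_plane_def hull_inc)
  with assms(2) have "r 0 + v \<in> orbital_plane r"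
    by (simp add: parallel_to_def)
  then have "w \<bullet> (r 0 + v) = c"
    by (rule inner_orbital_plane[OF assms(1)])
  with assms(1)[of 0] show ?thesis
    by (simp add: inner_add_right)
qed

text \<open>Translating by \<open>(\<gamma> - \<beta>) *\<^sub>R a\<close> matches the two multiples
  of the base point \<open>a\<close>, and the directions of \<open>S\<close> are invariant under
  scaling.\<close>

lemma affine_parallel_scaleR:
  fixes S :: "'a::real_vector set"
  assumes S: "affine S" "a \<in> S" and "\<beta> \<noteq> 0" "\<gamma> \<noteq> 0"
  shows "affine_parallel ((*\<^sub>R) \<beta> ` S) ((*\<^sub>R) \<gamma> ` S)"
proof -
  have *: "\<exists>y\<in>S. \<gamma> *\<^sub>R x = (\<gamma> - \<beta>) *\<^sub>R a + \<beta> *\<^sub>R y" if "x \<in> S" "\<beta> \<noteq> 0" for x \<beta> \<gamma>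
  proof
    \<comment> \<open>The witness solves the required equation for \<open>y\<close> and is an affine
      combination of \<open>a\<close> and \<open>x\<close>.\<close>
    show "(1 - \<gamma> / \<beta>) *\<^sub>R a + (\<gamma> / \<beta>) *\<^sub>R x \<in> S"
      using S that by (intro mem_affine) auto
    show "\<gamma> *\<^sub>R x = (\<gamma> - \<beta>) *\<^sub>R a + \<beta> *\<^sub>R ((1 - \<gamma> / \<beta>) *\<^sub>R a + (\<gamma> / \<beta>) *\<^sub>R x)"
      using that by (simp add: algebra_simps)
  qed
  have "(*\<^sub>R) \<gamma> ` S = (\<lambda>x. (\<gamma> - \<beta>) *\<^sub>R a + x) ` (*\<^sub>R) \<beta> ` S"
  proof (intro equalityI subsetI)
    fix z assume "z \<in> (*\<^sub>R) \<gamma> ` S"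
    then show "z \<in> (\<lambda>x. (\<gamma> - \<beta>) *\<^sub>R a + x) ` (*\<^sub>R) \<beta> ` S"
      using *[of _ \<beta> \<gamma>] assms by fastforce
  next
    fix z assume "z \<in> (\<lambda>x. (\<gamma> - \<beta>) *\<^sub>R a + x) ` (*\<^sub>R) \<beta> ` S"
    then obtain x where x: "x \<in> S" "z = (\<gamma> - \<beta>) *\<^sub>R a + \<beta> *\<^sub>R x" by auto
    from *[of x \<gamma> \<beta>] x assms obtain y where "y \<in> S" "\<beta> *\<^sub>R x = (\<beta> - \<gamma>) *\<^sub>R a + \<gamma> *\<^sub>R y" by blast
    with x have "y \<in> S" "z = \<gamma> *\<^sub>R y" by (simp_all add: algebra_simps)
    then show "z \<in> (*\<^sub>R) \<gamma> ` S" by blast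
  qed
  then show ?thesis unfolding affine_parallel_def by blast
qed

lemma orbital_plane_scaleR: "orbital_plane (\<lambda>t. \<beta> *\<^sub>R r t) = (*\<^sub>R) \<beta> ` orbital_plane r"
proof -
  have "linear ((*\<^sub>R) \<beta> :: real^3 \<Rightarrow> _)"
    by (rule linear_scaleR)
  from affine_hull_linear_image[of _ "range r", OF this[unfolded linear_conv_bounded_linear]]
  show ?thesis
    by (simp add: orbital_plane_def image_image)
qed

text \<open>The two orbits lie in the hyperplanes where the inner product with \<open>w\<close> is
  \<open>?\<beta> * c\<close> and \<open>?\<gamma> * c\<close>; these values have opposite
  signs.\<close>

lemma non_lagrangian_of_inner_const:
  assumes r: "\<And>t. w \<bullet> r t = c" and c: "c \<noteq> 0" and m: "0 < mp" "0 < mb"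
  shows "non_lagrangian mp mb r"
proof -
  let ?\<beta> = "mb / (mp + mb)" and ?\<gamma> = "- (mp / (mp + mb))"
  have pos: "?\<beta> > 0" "?\<gamma> < 0" using m by simp_all
  have r0: "r 0 \<in> orbital_plane r"
    by (simp add: orbital_plane_def hull_inc)
  have "affine_parallel ((*\<^sub>R) ?\<beta> ` orbital_plane r) ((*\<^sub>R) ?\<gamma> ` orbital_plane r)"
    using pos r0 by (intro affine_parallel_scaleR[of _ "r 0"]) (auto simp: orbital_plane_def simp del: neg_less_0_iff_less)
  moreover have "?\<beta> *\<^sub>R r 0 \<notin> (*\<^sub>R) ?\<gamma> ` orbital_plane r"
  proof
    assume "?\<beta> *\<^sub>R r 0 \<in> (*\<^sub>R) ?\<gamma> ` orbital_plane r"
    then obtain x where x: "x \<in> orbital_plane r" "?\<beta> *\<^sub>R r 0 = ?\<gamma> *\<^sub>R x" by auto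
    have "w \<bullet> (?\<beta> *\<^sub>R r 0) = w \<bullet> (?\<gamma> *\<^sub>R x)"
      using x(2) by simp
    then have "?\<beta> * c = ?\<gamma> * c"
      unfolding inner_scaleR_right r inner_orbital_plane[OF r x(1)] .
    with c have "?\<beta> = ?\<gamma>" by (metis mult_right_cancel)
    with pos show False by linarith
  qed
  ultimately show ?thesis
    unfolding non_lagrangian_def orbital_plane_scaleR using r0 by blast
qed

lemma cross_derivation: "x \<times> (y \<times> z) = (x \<times> y) \<times> z + y \<times> (x \<times> z)"
  using Jacobi[of x y z] cross_skew[of z "x \<times> y"] cross_skew[of z x] by (simp add: algebra_simps)

text \<open>Every inertial vector involved is \<open>X x t\<close> for a constant body vector
  \<open>x\<close>. As \<open>X\<close> preserves inner and cross products and differentiation acts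
  on \<open>x\<close> as \<open>V0 \<times> x\<close>, the claims reduce to computations with
  constant vectors.\<close>

lemma conic_precession_inertial:
  fixes A C :: real
  assumes A: "A > 0" and C: "C > 0"
    and Q: "attitude Q (\<lambda>t. angular_velocity A C (rot3 (N * t) *v G0))"
    and r: "r = (\<lambda>t. Q t *v (rot3 (N * t) *v R0))" and r': "r' = (\<lambda>t. vector_derivative r (at t))"
    and z: "z = (\<lambda>t. Q t *v vector [0, 0, 1])" and c: "c = (\<lambda>t. r t \<times> r' t)"
    and R0: "R0 = vector [R1, R2, R3]" and G0: "G0 = vector [A * W1, A * W2, C * W3]"
    and V3: "V3 = W3 + N" and V0: "V0 = vector [W1, W2, V3]"
    and \<rho>: "\<rho> = sqrt (R1\<^sup>2 + R2\<^sup>2)" "\<rho> \<noteq> 0"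
    and nz: "\<kappa> \<noteq> 0" "d \<noteq> 0" and d: "d = V3 - \<kappa> * R3" and W: "W1 = \<kappa> * R1" "W2 = \<kappa> * R2"
    and Ur: "Ur = \<rho> * V3 * d" and U3: "U3 = - \<kappa> * \<rho>\<^sup>2 * d" and K: "K = \<rho> * Ur + R3 * U3"
    and n: "\<kappa> * (A * V3 - C * W3) = d * (\<kappa> * \<rho>\<^sup>2 + R3 * V3)" and VR: "\<kappa> * \<rho>\<^sup>2 + R3 * V3 \<noteq> 0"
    and U: "axisymmetric_potential D U" and eq: "relative_equilibrium A C D U R0 P0 G0 N"
    and P0v: "P0 = vector [- R2 * d, R1 * d, 0]" and U3_grad: "U3 = grad U R0 $ 3"
    and L: "R0 \<times> P0 + G0 \<noteq> 0"
  shows "\<exists>l. \<forall>t.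
    l = Q t *v ((rot3 (N * t) *v R0) \<times> (rot3 (N * t) *v P0) + rot3 (N * t) *v G0) \<and>
    (r has_vector_derivative r' t) (at t) \<and>
    l \<bullet> r t = G0 \<bullet> R0 \<and>
    (Ur \<noteq> 0 \<longrightarrow>
       G0 \<bullet> R0 = Ur * (A * U3 + R3 * K) / (U3 * K * V3) * (R3 * Ur - \<rho> * U3)) \<and>
    G0 \<bullet> R0 \<noteq> 0 \<and>
    (\<forall>mp mb. 0 < mp \<and> 0 < mb \<longrightarrow> non_lagrangian mp mb r) \<and>
    r t \<bullet> z t = R3 \<and>
    r' t \<bullet> z t = 0 \<and>
    c t \<bullet> z t = (R0 \<times> (V0 \<times> R0)) \<bullet> vector [0, 0, 1] \<and>
    l \<bullet> z t = (R0 \<times> (V0 \<times> R0)) \<bullet> vector [0, 0, 1] + C * W3 \<and>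
    (Ur \<noteq> 0 \<longrightarrow>
       (R0 \<times> (V0 \<times> R0)) \<bullet> vector [0, 0, 1] = \<rho> * Ur / V3 \<and>
       l \<bullet> z t = \<rho> * Ur / V3 + C * W3) \<and>
    z t \<in> span {r t, c t} \<and>
    z t \<in> span {r t, l} \<and>
    (Ur \<noteq> 0 \<longrightarrow> inclined_to (z t) (orbital_plane r)) \<and>
    (R3 \<noteq> 0 \<longrightarrow> inclined_to (z t) (span {r t, r' t})) \<and>
    \<not> perpendicular_to (c t) (orbital_plane r)"
proof -
  let ?e = "vector [0, 0, 1] :: real^3"
  let ?l = "R0 \<times> P0 + G0"
  let ?c = "R0 \<times> P0"
  define X where "X x t = Q t *v (rot3 (N * t) *v x)" for x t
  have \<rho>2: "\<rho>\<^sup>2 = R1\<^sup>2 + R2\<^sup>2" by (simp add: \<rho>)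
  have V0_eq: "V0 = angular_velocity A C G0 + N *\<^sub>R ?e"
    using A C by (simp add: angular_velocity_eq G0 V3 V0 vec_eq_iff forall_3)
  define g where "g = grad U R0"
  have P0: "P0 = V0 \<times> R0" and VP: "V0 \<times> P0 = - g" and VG: "V0 \<times> G0 = R0 \<times> g"
    using eq relative_equilibrium_iff[OF _ _ U V0_eq] A C by (auto simp: g_def)
  have X_deriv: "(X x has_vector_derivative X (V0 \<times> x) t) (at t)" for x t
    using has_vector_derivative_attitude_rot3[of Q N "angular_velocity A C G0" x t] Q A C
    by (simp add: X_def[abs_def] angular_velocity_rot3 V0_eq)
  have rot: "rotation_matrix (Q t)" for t
    using Q by (simp add: attitude_def)
  have X_inner: "X x t \<bullet> X y t = x \<bullet> y" for x y t
    by (simp add: X_def inner_rotation_matrix rot rotation_matrix_rot3)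
  have X_cross: "X x t \<times> X y t = X (x \<times> y) t" for x y t
    by (simp add: X_def cross_rotation_matrix rot rotation_matrix_rot3)
  have X_const: "X x t = X x 0" if "V0 \<times> x = 0" for x t
  proof -
    have "X 0 = (\<lambda>t. 0)" by (simp add: X_def fun_eq_iff)
    then have "(X x has_derivative (\<lambda>h. 0)) (at s)" for s
      using X_deriv[of x s] that by (simp add: has_vector_derivative_def)
    then show ?thesis
      using has_derivative_zero_unique[of UNIV "X x" t 0] by auto
  qed
  have X_span: "X u t \<in> span {X x t, X y t}" if "u = a *\<^sub>R x + b *\<^sub>R y" for u x y a b t
  proof -
    have "X u t = a *\<^sub>R X x t + b *\<^sub>R X y t"
      by (simp add: that X_def matrix_vector_right_distrib matrix_vector_mult_scaleR)
    then show ?thesis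
      by (auto intro!: span_add span_scale intro: span_base)
  qed
  have rX: "r = X R0" by (simp add: r X_def fun_eq_iff)
  have rX': "r' = X P0"
    using X_deriv[of R0] by (auto simp: r' rX P0 fun_eq_iff intro: vector_derivative_at)
  have zX: "z = X ?e"
  proof -
    have "rot3 a *v ?e = ?e" for a
      by (simp add: rot3_mult vec_eq_iff forall_3)
    then show ?thesis by (simp add: z X_def fun_eq_iff)
  qed
  have cX: "c = X ?c" by (simp add: c rX rX' X_cross)
  have r_deriv: "(r has_vector_derivative r' t) (at t)" for t
    using X_deriv[of R0 t] by (simp add: rX rX' P0)
  have r'_deriv: "(r' has_vector_derivative X (- g) t) (at t)" for t
    using X_deriv[of P0 t] by (simp add: rX' VP)
  have cv: "?c = vector [- R3 * d * R1, - R3 * d * R2, \<rho>\<^sup>2 * d]"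
    by (simp add: P0v R0 cross3_def vec_eq_iff forall_3 \<rho>2) (simp add: algebra_simps power2_eq_square)
  have lv: "?l = vector [(A * \<kappa> - R3 * d) * R1, (A * \<kappa> - R3 * d) * R2, \<rho>\<^sup>2 * d + C * W3]"
    unfolding R0 P0v G0 W by (rule conic_angular_momentum(1)[OF \<rho>2 refl])
  have gv: "g = vector [R1 * (V3 * d), R2 * (V3 * d), U3]"
  proof -
    have "g = - (V0 \<times> P0)" using VP by simp
    then show ?thesis
      by (simp add: V0 P0v W cross3_def vec_eq_iff forall_3 U3 \<rho>2) (simp add: algebra_simps power2_eq_square)
  qed
  have VR_inner: "V0 \<bullet> R0 = \<kappa> * \<rho>\<^sup>2 + R3 * V3"
    by (simp add: V0 R0 W inner_vec_def sum_3 \<rho>2) (simp add: algebra_simps power2_eq_square)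
  have GR_inner: "G0 \<bullet> R0 = A * \<kappa> * \<rho>\<^sup>2 + C * W3 * R3"
    by (simp add: G0 R0 W inner_vec_def sum_3 \<rho>2) (simp add: algebra_simps power2_eq_square)
  note rel = conic_relations[OF \<rho>(2) nz d Ur U3 K n refl]
  \<comment> \<open>If it vanished, the vertical part of the angular momentum would vanish as well,
    against \<open>L\<close>.\<close>
  have \<mu>: "A * \<kappa> - R3 * d \<noteq> 0"
  proof
    assume "A * \<kappa> - R3 * d = 0"
    moreover from this rel(4) nz have "\<rho>\<^sup>2 * d + C * W3 = 0" by simp
    ultimately have "?l = 0"
      unfolding lv by (simp add: vec_eq_iff forall_3)
    with L show False by blast
  qed
  have GR0: "G0 \<bullet> R0 \<noteq> 0"
    using rel(8) \<mu> VR unfolding GR_inner by auto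
  \<comment> \<open>Conservation of total angular momentum: the torques on orbit and body
    cancel.\<close>
  have Vl: "V0 \<times> ?l = 0"
    using cross_derivation[of V0 R0 P0] by (simp add: cross_add_right VP VG P0[symmetric])
  have w: "X V0 0 \<bullet> r t = V0 \<bullet> R0" for t
    using X_const[of V0 t] X_inner[of V0 t R0] by (simp add: rX)
  have l: "X ?l 0 = X ?l t" for t
    using X_const[OF Vl, of t] by simp
  have ce: "?c \<bullet> ?e = \<rho>\<^sup>2 * d"
    unfolding cv by (simp add: inner_vec_def sum_3)
  have le: "?l \<bullet> ?e = \<rho>\<^sup>2 * d + C * W3"
    unfolding lv by (simp add: inner_vec_def sum_3)
  have V3_iff: "Ur \<noteq> 0 \<longleftrightarrow> V3 \<noteq> 0"
    using \<rho>(2) nz by (simp add: Ur)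
  have Ur_V3: "\<rho> * Ur / V3 = \<rho>\<^sup>2 * d" if "V3 \<noteq> 0"
    using that by (simp add: Ur power2_eq_square)
  have span_c: "z t \<in> span {r t, c t}" for t
  proof -
    have pos: "R3\<^sup>2 + \<rho>\<^sup>2 \<noteq> 0" using \<rho>(2) by (simp add: sum_power2_eq_zero_iff)
    \<comment> \<open>\<open>R0\<close> and \<open>?c\<close> are orthogonal; the coefficients are
      those of the projections of \<open>?e\<close> onto them.\<close>
    have "?e = (R3 / (R3\<^sup>2 + \<rho>\<^sup>2)) *\<^sub>R R0 + (1 / ((R3\<^sup>2 + \<rho>\<^sup>2) * d)) *\<^sub>R ?c"
      unfolding cv using pos nz
      by (simp add: R0 vec_eq_iff forall_3 add_divide_distrib[symmetric] power2_eq_square[symmetric])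
    then show ?thesis
      unfolding rX cX zX by (rule X_span)
  qed
  have span_l: "z t \<in> span {r t, X ?l t}" for t
  proof -
    let ?\<mu> = "A * \<kappa> - R3 * d"
    have "\<kappa> * (\<rho>\<^sup>2 * d + C * W3) = ?\<mu> * (d + \<kappa> * R3)"
      using rel(4) by (simp add: d mult.commute)
    then have "\<kappa> * (\<rho>\<^sup>2 * d + C * W3) / (?\<mu> * d) = (d + \<kappa> * R3) / d"
      using \<mu> by simp
    \<comment> \<open>This is \<open>V0 - \<kappa> *\<^sub>R R0 = d *\<^sub>R ?e\<close>, with
      \<open>V0\<close> written as \<open>\<kappa> / ?\<mu>\<close> times \<open>?l\<close>.\<close>
    then have "?e = (- \<kappa> / d) *\<^sub>R R0 + (\<kappa> / (?\<mu> * d)) *\<^sub>R ?l"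
      unfolding lv using \<mu> nz
      by (simp add: R0 vec_eq_iff forall_3 add_divide_distrib)
    then show ?thesis
      unfolding rX zX by (rule X_span)
  qed
  \<comment> \<open>The acceleration has a component \<open>- U3\<close> along the symmetry axis,
    which excludes perpendicularity. The fixed vector \<open>X V0 0\<close> is normal to the orbit
    and has inner product \<open>V3\<close> with the axis, which excludes parallelism.\<close>
  have incl: "inclined_to (z t) (orbital_plane r)" if "V3 \<noteq> 0" for t
  proof -
    have "z t \<bullet> X (- g) t \<noteq> 0"
      unfolding zX X_inner gv using nz \<rho>(2) by (simp add: inner_vec_def sum_3 U3)
    moreover have "X V0 0 \<bullet> z t \<noteq> 0"
      unfolding zX X_const[of V0 t, OF cross_refl, symmetric] X_inner
      using that by (simp add: V0 inner_vec_def sum_3)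
    ultimately show ?thesis
      unfolding inclined_to_def
      using perpendicular_orbital_plane[OF r_deriv r'_deriv] parallel_orbital_plane[where r = r, OF w] by blast
  qed
  have Re: "r t \<bullet> z t = R3" "r' t \<bullet> z t = 0" for t
    unfolding rX rX' zX X_inner by (simp_all add: R0 P0v inner_vec_def sum_3)
  have cz: "c t \<bullet> z t = \<rho>\<^sup>2 * d" for t
    by (simp add: cX zX X_inner ce)
  \<comment> \<open>This is the plane of the orbital frame. It passes through the origin, whereas
    the affine hull of the orbit does not, so the two planes are treated separately.\<close>
  have incl_span: "inclined_to (z t) (span {r t, r' t})" if "R3 \<noteq> 0" for t
  proof -
    have "r t \<in> span {r t, r' t}" "0 \<in> span {r t, r' t}"
      by (auto intro: span_base span_zero)
    moreover have "z t \<bullet> (r t - 0) \<noteq> 0"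
      using that Re(1)[of t] by (simp add: inner_commute)
    ultimately have "\<not> perpendicular_to (z t) (span {r t, r' t})"
      unfolding perpendicular_to_def by blast
    moreover have "span {r t, r' t} \<subseteq> {x. c t \<bullet> x = 0}"
      by (rule span_minimal) (auto simp: c dot_cross_self subspace_hyperplane)
    then have "\<not> parallel_to (z t) (span {r t, r' t})"
      using cz[of t] \<rho>(2) nz \<open>0 \<in> _\<close> unfolding parallel_to_def by force
    ultimately show ?thesis by (simp add: inclined_to_def)
  qed
  have c_perp: "\<not> perpendicular_to (c t) (orbital_plane r)" for t
  proof -
    \<comment> \<open>The last factor is \<open>V0 \<bullet> R0\<close>, the same quantity that
      separates the orbital planes.\<close>
    have "c t \<bullet> X (- g) t = \<rho>\<^sup>2 * d\<^sup>2 * (\<kappa> * \<rho>\<^sup>2 + R3 * V3)"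
      unfolding cX X_inner cv
      by (simp add: gv inner_vec_def sum_3 U3 \<rho>2) (simp add: algebra_simps power2_eq_square)
    then show ?thesis
      using perpendicular_orbital_plane[OF r_deriv r'_deriv, of "c t" t] \<rho>(2) nz VR by auto
  qed
  show ?thesis
  proof (intro exI[of _ "X ?l 0"] allI, goal_cases)
    case (1 t)
    have "X ?l 0 = Q t *v ((rot3 (N * t) *v R0) \<times> (rot3 (N * t) *v P0) + rot3 (N * t) *v G0)"
      unfolding l[of t] unfolding X_def
      by (simp add: cross_rotation_matrix rotation_matrix_rot3 matrix_vector_right_distrib)
    moreover have "X ?l 0 \<bullet> r t = G0 \<bullet> R0"
      unfolding l[of t] rX X_inner by (simp add: inner_add_left dot_cross_self)
    moreover have "X ?l 0 \<bullet> z t = \<rho>\<^sup>2 * d + C * W3"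
      unfolding l[of t] zX X_inner le ..
    moreover have "z t \<in> span {r t, X ?l 0}"
      unfolding l[of t] by (rule span_l)
    moreover have "non_lagrangian mp mb r" if "0 < mp" "0 < mb" for mp mb
      using non_lagrangian_of_inner_const[where r = r, OF w _ that] VR unfolding VR_inner .
    ultimately show ?case
      unfolding V3_iff P0[symmetric] ce cz
      using r_deriv GR0 Re rel(9) Ur_V3 span_c incl incl_span c_perp
      unfolding GR_inner by simp
  qed
qed

section \<open>Conic precessions\<close>

text \<open>The equilibrium equations admit \<open>V3 = 0\<close> together with
  \<open>U\<rho> = 0\<close>, and also \<open>R3 = 0\<close> with \<open>U3 \<noteq> 0\<close>.
  Formulas dividing by \<open>V3\<close> or \<open>R3\<close> are therefore guarded, and
  \<open>R3 \<noteq> 0\<close> is asserted when \<open>R3 = 0\<close> would force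
  \<open>U3 = 0\<close>, as equatorial reflection symmetry does. For \<open>W3 = 0\<close> reversing
  all momenta and \<open>N\<close> gives a second equilibrium, hence uniqueness up to that
  sign.\<close>

theorem mainTheorem4:
  fixes A C :: real and U :: "real^3 \<Rightarrow> real" and D :: "(real^3) set"
  assumes A_pos: "0 < A" and C_pos: "0 < C"
    and U: "axisymmetric_potential D U"
  shows
    "(\<forall>R0 P0 G0 N L R1 R2 R3 P1 P2 P3 W1 W2 W3 G3 V3 V0 \<rho> U\<rho> U3 K.
        relative_equilibrium A C D U R0 P0 G0 N \<and>
        grad U R0 \<noteq> 0 \<and>
        L = norm (R0 \<times> P0 + G0) \<and> L \<noteq> 0 \<and>
        \<not> locally_central U R0 \<and>
        R0 = vector [R1, R2, R3] \<and>
        P0 = vector [P1, P2, P3] \<and>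
        G0 = vector [A * W1, A * W2, C * W3] \<and>
        G3 = C * W3 \<and>
        V3 = W3 + N \<and> V0 = vector [W1, W2, V3] \<and>
        \<rho> = sqrt (R1\<^sup>2 + R2\<^sup>2) \<and>
        U\<rho> = grad_rho U R0 \<and> U3 = grad U R0 $ 3 \<and>
        K = \<rho> * U\<rho> + R3 * U3
      \<longrightarrow>
        P3 = R2 * W1 - R1 * W2 \<and> R2 * W1 - R1 * W2 = 0 \<and>
        \<rho> \<noteq> 0 \<and>
        ((R3 = 0 \<longrightarrow> U3 = 0) \<longrightarrow> R3 \<noteq> 0) \<and>
        (U\<rho> \<noteq> 0 \<longrightarrow>
           V3 \<noteq> 0 \<and>
           P1 = - R2 * (U\<rho> / (V3 * \<rho>)) \<and>
           P2 = R1 * (U\<rho> / (V3 * \<rho>)) \<and>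
           (R3 \<noteq> 0 \<longrightarrow>
              W1 = R1 * ((\<rho> * V3\<^sup>2 - U\<rho>) / (\<rho> * R3 * V3)) \<and>
              W2 = R2 * ((\<rho> * V3\<^sup>2 - U\<rho>) / (\<rho> * R3 * V3)))) \<and>
        (V3 \<noteq> 0 \<longrightarrow> U\<rho> \<noteq> 0) \<and>
        K * V3\<^sup>2 = U\<rho>\<^sup>2 \<and>
        (A * V3 - C * W3) * U\<rho> * U3 = K * (\<rho> * U3 - R3 * U\<rho>) * V3 \<and>
        (U\<rho> \<noteq> 0 \<longrightarrow>
           L\<^sup>2 = ((A + R3\<^sup>2) * U3 + \<rho> * R3 * U\<rho>)\<^sup>2 / K + (\<rho> * U\<rho> / V3 + G3)\<^sup>2) \<and>
        U3 \<noteq> 0 \<and> K \<noteq> 0 \<and>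
        L\<^sup>2 * U3\<^sup>2 * K = (U\<rho>\<^sup>2 + U3\<^sup>2) * (A * U3 + R3 * K)\<^sup>2 \<and>
        C\<^sup>2 * W3\<^sup>2 * U3\<^sup>2 * K = (A * U\<rho> * U3 + K * (R3 * U\<rho> - \<rho> * U3))\<^sup>2 \<and>
        (\<forall>Q r r' z c.
           attitude Q (\<lambda>t. angular_velocity A C (rot3 (N * t) *v G0)) \<and>
           r = (\<lambda>t. Q t *v (rot3 (N * t) *v R0)) \<and>
           r' = (\<lambda>t. vector_derivative r (at t)) \<and>
           z = (\<lambda>t. Q t *v vector [0, 0, 1]) \<and>
           c = (\<lambda>t. r t \<times> r' t)
         \<longrightarrow>
           (\<exists>l. \<forall>t.
              l = Q t *v ((rot3 (N * t) *v R0) \<times> (rot3 (N * t) *v P0) + rot3 (N * t) *v G0) \<and>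
              (r has_vector_derivative r' t) (at t) \<and>
              l \<bullet> r t = G0 \<bullet> R0 \<and>
              (U\<rho> \<noteq> 0 \<longrightarrow>
                 G0 \<bullet> R0 = U\<rho> * (A * U3 + R3 * K) / (U3 * K * V3) * (R3 * U\<rho> - \<rho> * U3)) \<and>
              G0 \<bullet> R0 \<noteq> 0 \<and>
              (\<forall>mp mb. 0 < mp \<and> 0 < mb \<longrightarrow> non_lagrangian mp mb r) \<and>
              r t \<bullet> z t = R3 \<and>
              r' t \<bullet> z t = 0 \<and>
              c t \<bullet> z t = (R0 \<times> (V0 \<times> R0)) \<bullet> vector [0, 0, 1] \<and>
              l \<bullet> z t = (R0 \<times> (V0 \<times> R0)) \<bullet> vector [0, 0, 1] + C * W3 \<and>
              (U\<rho> \<noteq> 0 \<longrightarrow>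
                 (R0 \<times> (V0 \<times> R0)) \<bullet> vector [0, 0, 1] = \<rho> * U\<rho> / V3 \<and>
                 l \<bullet> z t = \<rho> * U\<rho> / V3 + C * W3) \<and>
              z t \<in> span {r t, c t} \<and>
              z t \<in> span {r t, l} \<and>
              (U\<rho> \<noteq> 0 \<longrightarrow> inclined_to (z t) (orbital_plane r)) \<and>
              (R3 \<noteq> 0 \<longrightarrow> inclined_to (z t) (span {r t, r' t})) \<and>
              \<not> perpendicular_to (c t) (orbital_plane r)))) \<and>
     (\<forall>L W3 R0 R1 R2 R3 \<rho> U\<rho> U3 K.
        0 < L \<and>
        R0 \<in> D \<and> R0 = vector [R1, R2, R3] \<and>
        \<rho> = sqrt (R1\<^sup>2 + R2\<^sup>2) \<and>
        U\<rho> = grad_rho U R0 \<and> U3 = grad U R0 $ 3 \<and>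
        K = \<rho> * U\<rho> + R3 * U3 \<and>
        \<not> locally_central U R0 \<and> R3 \<noteq> 0 \<and> U\<rho> \<noteq> 0 \<and>
        L\<^sup>2 * U3\<^sup>2 * K = (U\<rho>\<^sup>2 + U3\<^sup>2) * (A * U3 + R3 * K)\<^sup>2 \<and>
        C\<^sup>2 * W3\<^sup>2 * U3\<^sup>2 * K = (A * U\<rho> * U3 + K * (R3 * U\<rho> - \<rho> * U3))\<^sup>2
      \<longrightarrow>
        (\<exists>V3 P0 G0.
           V3 \<noteq> 0 \<and> K * V3\<^sup>2 = U\<rho>\<^sup>2 \<and>
           P0 = vector [- R2 * (U\<rho> / (V3 * \<rho>)), R1 * (U\<rho> / (V3 * \<rho>)), 0] \<and>
           G0 = vector [A * (R1 * ((\<rho> * V3\<^sup>2 - U\<rho>) / (\<rho> * R3 * V3))),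
                        A * (R2 * ((\<rho> * V3\<^sup>2 - U\<rho>) / (\<rho> * R3 * V3))),
                        C * W3] \<and>
           relative_equilibrium A C D U R0 P0 G0 (V3 - W3) \<and>
           norm (R0 \<times> P0 + G0) = L) \<and>
        (\<forall>P0 G0 N P0' G0' N'.
           relative_equilibrium A C D U R0 P0 G0 N \<and>
           norm (R0 \<times> P0 + G0) = L \<and> G0 $ 3 = C * W3 \<and>
           relative_equilibrium A C D U R0 P0' G0' N' \<and>
           norm (R0 \<times> P0' + G0') = L \<and> G0' $ 3 = C * W3
         \<longrightarrow>
           (P0' = P0 \<and> G0' = G0 \<and> N' = N) \<or>
           (W3 = 0 \<and> P0' = - P0 \<and> G0' = - G0 \<and> N' = - N)))"
proof ((rule conjI; intro allI impI), goal_cases)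

  \<comment> \<open>Properties of a given equilibrium\<close>
  case (1 R0 P0 G0 N L R1 R2 R3 P1 P2 P3 W1 W2 W3 G3 V3 V0 \<rho> U\<rho> U3 K)
  then have eq: "relative_equilibrium A C D U R0 P0 G0 N" and L: "L = norm (R0 \<times> P0 + G0)" "L \<noteq> 0"
    and nc: "\<not> locally_central U R0" and R0: "R0 = vector [R1, R2, R3]" and P0: "P0 = vector [P1, P2, P3]"
    and G0: "G0 = vector [A * W1, A * W2, C * W3]" and G3: "G3 = C * W3"
    and V3: "V3 = W3 + N" and V0: "V0 = vector [W1, W2, V3]" and \<rho>: "\<rho> = sqrt (R1\<^sup>2 + R2\<^sup>2)"
    and Ur: "U\<rho> = grad_rho U R0" and U3: "U3 = grad U R0 $ 3" and K: "K = \<rho> * U\<rho> + R3 * U3"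
    by blast+
  obtain \<kappa> d where \<rho>_pos: "\<rho> > 0" and \<kappa>d: "\<kappa> \<noteq> 0" "d \<noteq> 0" and d: "d = V3 - \<kappa> * R3"
    and W: "W1 = \<kappa> * R1" "W2 = \<kappa> * R2"
    and P0': "P0 = vector [- R2 * d, R1 * d, 0]" and Ur': "U\<rho> = \<rho> * V3 * d" and U3': "U3 = - \<kappa> * \<rho>\<^sup>2 * d"
    and n: "\<kappa> * (A * V3 - C * W3) = d * (\<kappa> * \<rho>\<^sup>2 + R3 * V3)" and VR: "\<kappa> * \<rho>\<^sup>2 + R3 * V3 \<noteq> 0"
    by (rule not_locally_central_conic[OF A_pos C_pos U eq nc R0 G0 V3 \<rho> Ur U3])
  have \<rho>0: "\<rho> \<noteq> 0" using \<rho>_pos by simp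
  have \<rho>2: "\<rho>\<^sup>2 = R1\<^sup>2 + R2\<^sup>2" by (simp add: \<rho>)
  have L2: "L\<^sup>2 = \<rho>\<^sup>2 * (A * \<kappa> - R3 * d)\<^sup>2 + (\<rho>\<^sup>2 * d + C * W3)\<^sup>2"
    unfolding L(1) R0 P0' G0 W by (rule conic_angular_momentum(2)[OF \<rho>2 refl])
  note rel = conic_relations[OF \<rho>0 \<kappa>d d Ur' U3' K n L2]
  have P: "P1 = - R2 * d" "P2 = R1 * d" "P3 = 0"
    using P0 P0' by (simp_all add: vec_eq_iff forall_3)
  have V3_iff: "U\<rho> \<noteq> 0 \<longleftrightarrow> V3 \<noteq> 0"
    using \<rho>0 \<kappa>d by (simp add: Ur')
  have d_eq: "U\<rho> / (V3 * \<rho>) = d" if "V3 \<noteq> 0"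
    using that \<rho>0 by (simp add: Ur')
  have \<kappa>_eq: "(\<rho> * V3\<^sup>2 - U\<rho>) / (\<rho> * R3 * V3) = \<kappa>" if "V3 \<noteq> 0" "R3 \<noteq> 0"
  proof -
    have "\<rho> * V3\<^sup>2 - U\<rho> = \<rho> * V3 * (\<kappa> * R3)"
      by (simp add: Ur' d algebra_simps power2_eq_square)
    then show ?thesis
      using that \<rho>0 by simp
  qed
  have nz: "U3 \<noteq> 0" "K \<noteq> 0"
    using \<rho>0 \<kappa>d rel(1) U3' by simp_all
  have l0: "R0 \<times> P0 + G0 \<noteq> 0" using L by auto
  show ?case
  proof (intro conjI allI impI)
    fix Q r r' z c
    assume "attitude Q (\<lambda>t. angular_velocity A C (rot3 (N * t) *v G0)) \<and>
       r = (\<lambda>t. Q t *v (rot3 (N * t) *v R0)) \<and>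
       r' = (\<lambda>t. vector_derivative r (at t)) \<and>
       z = (\<lambda>t. Q t *v vector [0, 0, 1]) \<and>
       c = (\<lambda>t. r t \<times> r' t)"
    then have "attitude Q (\<lambda>t. angular_velocity A C (rot3 (N * t) *v G0))"
       "r = (\<lambda>t. Q t *v (rot3 (N * t) *v R0))"
       "r' = (\<lambda>t. vector_derivative r (at t))"
       "z = (\<lambda>t. Q t *v vector [0, 0, 1])"
       "c = (\<lambda>t. r t \<times> r' t)"
      by blast+
    note inertial = conic_precession_inertial[OF A_pos C_pos this R0 G0 V3 V0 \<rho> \<rho>0 \<kappa>d d W Ur' U3' K n VR U eq P0' U3 l0]
    show "\<exists>l. \<forall>t.
          l = Q t *v ((rot3 (N * t) *v R0) \<times> (rot3 (N * t) *v P0) + rot3 (N * t) *v G0) \<and>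
          (r has_vector_derivative r' t) (at t) \<and>
          l \<bullet> r t = G0 \<bullet> R0 \<and>
          (U\<rho> \<noteq> 0 \<longrightarrow>
             G0 \<bullet> R0 = U\<rho> * (A * U3 + R3 * K) / (U3 * K * V3) * (R3 * U\<rho> - \<rho> * U3)) \<and>
          G0 \<bullet> R0 \<noteq> 0 \<and>
          (\<forall>mp mb. 0 < mp \<and> 0 < mb \<longrightarrow> non_lagrangian mp mb r) \<and>
          r t \<bullet> z t = R3 \<and>
          r' t \<bullet> z t = 0 \<and>
          c t \<bullet> z t = (R0 \<times> (V0 \<times> R0)) \<bullet> vector [0, 0, 1] \<and>
          l \<bullet> z t = (R0 \<times> (V0 \<times> R0)) \<bullet> vector [0, 0, 1] + C * W3 \<and>
          (U\<rho> \<noteq> 0 \<longrightarrow>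
             (R0 \<times> (V0 \<times> R0)) \<bullet> vector [0, 0, 1] = \<rho> * U\<rho> / V3 \<and>
             l \<bullet> z t = \<rho> * U\<rho> / V3 + C * W3) \<and>
          z t \<in> span {r t, c t} \<and>
          z t \<in> span {r t, l} \<and>
          (U\<rho> \<noteq> 0 \<longrightarrow> inclined_to (z t) (orbital_plane r)) \<and>
          (R3 \<noteq> 0 \<longrightarrow> inclined_to (z t) (span {r t, r' t})) \<and>
          \<not> perpendicular_to (c t) (orbital_plane r)" by (rule inertial)
  qed (use rel \<rho>0 nz V3_iff d_eq \<kappa>_eq P W G3 in \<open>simp_all add: mult.commute\<close>)
next

  \<comment> \<open>Equilibria obtained from the two scalar equations\<close>
  case (2 L W3 R0 R1 R2 R3 \<rho> U\<rho> U3 K)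
  then have L: "0 < L" and R0D: "R0 \<in> D" and R0: "R0 = vector [R1, R2, R3]"
    and \<rho>: "\<rho> = sqrt (R1\<^sup>2 + R2\<^sup>2)" and Ur: "U\<rho> = grad_rho U R0" and U3: "U3 = grad U R0 $ 3"
    and K: "K = \<rho> * U\<rho> + R3 * U3"
    and nc: "\<not> locally_central U R0" and nz: "R3 \<noteq> 0" "U\<rho> \<noteq> 0"
    and L_eq: "L\<^sup>2 * U3\<^sup>2 * K = (U\<rho>\<^sup>2 + U3\<^sup>2) * (A * U3 + R3 * K)\<^sup>2"
    and W_eq: "C\<^sup>2 * W3\<^sup>2 * U3\<^sup>2 * K = (A * U\<rho> * U3 + K * (R3 * U\<rho> - \<rho> * U3))\<^sup>2"
    by blast+
  have "axis_dist R0 = \<rho>" by (simp add: axis_dist_def R0 \<rho>)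
  then have \<rho>0: "\<rho> \<noteq> 0" and \<rho>_pos: "\<rho> > 0"
    using not_locally_central_off_axis[OF U R0D nc] by (auto simp: \<rho> less_le)
  have \<rho>2: "\<rho>\<^sup>2 = R1\<^sup>2 + R2\<^sup>2" by (simp add: \<rho>)
  obtain V3 \<kappa> d where V3: "V3 \<noteq> 0" "K * V3\<^sup>2 = U\<rho>\<^sup>2" and \<kappa>d: "\<kappa> \<noteq> 0" "d \<noteq> 0" and d: "d = V3 - \<kappa> * R3"
    and d_eq: "d = U\<rho> / (V3 * \<rho>)" and \<kappa>_eq: "\<kappa> = (\<rho> * V3\<^sup>2 - U\<rho>) / (\<rho> * R3 * V3)"
    and Ur': "U\<rho> = \<rho> * V3 * d" and U3': "U3 = - \<kappa> * \<rho>\<^sup>2 * d"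
    and n: "\<kappa> * (A * V3 - C * W3) = d * (\<kappa> * \<rho>\<^sup>2 + R3 * V3)"
    by (rule conic_solution[OF \<rho>_pos nz L A_pos K L_eq W_eq])
  let ?P0 = "vector [- R2 * d, R1 * d, 0] :: real^3"
  let ?G0 = "vector [A * (\<kappa> * R1), A * (\<kappa> * R2), C * W3] :: real^3"
  have ex: "relative_equilibrium A C D U R0 ?P0 ?G0 (V3 - W3)"
    by (rule conic_relative_equilibrium[OF A_pos C_pos U R0D R0 \<rho> \<rho>0 Ur'[unfolded Ur] U3'[unfolded U3] d n])
  note L2 = conic_angular_momentum(2)[OF \<rho>2 refl, of R3 d A \<kappa> C W3, folded R0]
  note rel = conic_relations[OF \<rho>0 \<kappa>d d Ur' U3' K n L2]
  have "U3 \<noteq> 0" "K \<noteq> 0"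
    using \<rho>0 \<kappa>d rel(1) U3' by simp_all
  \<comment> \<open>The constructed equilibrium satisfies the same \<open>L\<close> equation, so its
    angular momentum has the prescribed modulus.\<close>
  moreover have "(norm (R0 \<times> ?P0 + ?G0))\<^sup>2 * U3\<^sup>2 * K = L\<^sup>2 * U3\<^sup>2 * K"
    unfolding rel(6) L_eq ..
  ultimately have "(norm (R0 \<times> ?P0 + ?G0))\<^sup>2 = L\<^sup>2" by simp
  then have norm: "norm (R0 \<times> ?P0 + ?G0) = L"
    using L by (simp add: power2_eq_iff_nonneg)
  show ?case
  proof (intro conjI allI impI)
    show "\<exists>V3 P0 G0.
           V3 \<noteq> 0 \<and> K * V3\<^sup>2 = U\<rho>\<^sup>2 \<and>
           P0 = vector [- R2 * (U\<rho> / (V3 * \<rho>)), R1 * (U\<rho> / (V3 * \<rho>)), 0] \<and>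
           G0 = vector [A * (R1 * ((\<rho> * V3\<^sup>2 - U\<rho>) / (\<rho> * R3 * V3))),
                        A * (R2 * ((\<rho> * V3\<^sup>2 - U\<rho>) / (\<rho> * R3 * V3))),
                        C * W3] \<and>
           relative_equilibrium A C D U R0 P0 G0 (V3 - W3) \<and>
           norm (R0 \<times> P0 + G0) = L"
      by (rule exI[of _ V3], rule exI[of _ ?P0], rule exI[of _ ?G0], unfold d_eq[symmetric] \<kappa>_eq[symmetric])
        (use V3 ex norm in \<open>simp add: mult.commute\<close>)
  next
    fix P0 G0 :: "real^3" and N :: real and P0' G0' :: "real^3" and N' :: real
    assume H: "relative_equilibrium A C D U R0 P0 G0 N \<and>
           norm (R0 \<times> P0 + G0) = L \<and> G0 $ 3 = C * W3 \<and>
           relative_equilibrium A C D U R0 P0' G0' N' \<and>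
           norm (R0 \<times> P0' + G0') = L \<and> G0' $ 3 = C * W3"
    define V where "V = W3 + N"
    define V' where "V' = W3 + N'"
    have G3: "G0 $ 3 = C * W3" "G0' $ 3 = C * W3" using H by auto
    have eq: "relative_equilibrium A C D U R0 P0 G0 (V - W3)" "relative_equilibrium A C D U R0 P0' G0' (V' - W3)"
      using H by (simp_all add: V_def V'_def)
    note det = conic_determined[OF A_pos C_pos U eq(1) nc R0 G3(1) \<rho> Ur U3 K nz]
    note det' = conic_determined[OF A_pos C_pos U eq(2) nc R0 G3(2) \<rho> Ur U3 K nz]
    have "K * V'\<^sup>2 = K * V\<^sup>2" using det(1) det'(1) by simp
    then have "V' = V \<or> V' = - V"
      using det(3) by (simp add: power2_eq_iff)
    then show "(P0' = P0 \<and> G0' = G0 \<and> N' = N) \<or>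
           (W3 = 0 \<and> P0' = - P0 \<and> G0' = - G0 \<and> N' = - N)"
    proof
      assume "V' = V"
      then show ?thesis
        using det(5,6) det'(5,6) by (simp add: V_def V'_def)
    next
      assume V': "V' = - V"
      \<comment> \<open>The unsquared relation holds for both \<open>V\<close> and
        \<open>- V\<close>. Adding the two instances cancels everything odd in \<open>V\<close> and
        leaves the term with \<open>W3\<close>.\<close>
      have "2 * (C * W3 * U\<rho> * U3) = - ((A * V - C * W3) * U\<rho> * U3) - (A * V' - C * W3) * U\<rho> * U3"
        unfolding V' by algebra
      also have "\<dots> = 0"
        unfolding det(2) det'(2)[unfolded V'] V' by algebra
      finally have W3: "W3 = 0"
        using C_pos det(4) nz by simp
      then have "N' = - N" using V' by (simp add: V_def V'_def)
      \<comment> \<open>With \<open>W3 = 0\<close> the formulas for \<open>P0\<close> and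
        \<open>G0\<close> are odd in \<open>V\<close>.\<close>
      moreover have "P0' = - P0" "G0' = - G0"
        unfolding det(5,6) det'(5,6) V' W3 by (simp_all add: vec_eq_iff forall_3)
      ultimately show ?thesis using W3 by blast
    qed
  qed
qed

end
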